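(* Let $n\ge 5$ be odd and $m=\frac{2^n+1}{3}$. Let $\ell\ge 1$ be such that $\rho_{\ell+1}=(1,3,k)$, i.e. $\rho_{\ell+1}=9m+8k$, for some integer $0\le k<m$. Then $d_{ORD}(C_\ell(P_\infty))=\nu_\ell$.
   Context: Let $n\ge5$ be odd, $m=(2^n+1)/3$, and let $GGS(2,n)$ be (the nonsingular model of) the curve $X^2+X=Y^{3}$, $Y^{4}-Y=Z^m$; it is $\mathbb F_{2^{2n}}$-maximal of genus $g=\frac{9m-7}{2}$ and has a unique point at infinity $P_\infty$. The Weierstrass semigroup $H(P_\infty)$ (the set of $r\ge 0$ such that some rational function has pole divisor $rP_\infty$) is known to be $$H(P_\infty)=\{3im+2jm+8k \mid i\in\{0,1\},\ j\in\{0,1,2,3\},\ k\ge0\},$$ and each element has a unique such representation; $(i,j,k)$ denotes the element $3im+2jm+8k$. Write $H(P_\infty)=\{\rho_1=0<\rho_2<\rho_3<\cdots\}$. For $\ell\ge1$, $\nu_\ell$ is the number of ordered pairs $(a,b)\in H(P_\infty)\times H(P_\infty)$ with $a+b=\rho_{\ell+1}$. Let $\overline D$ be the sum of all $\mathbb F_{2^{2n}}$-rational points other than $P_\infty$, and $C_\ell(P_\infty)=C^\perp(\overline D,\rho_\ell P_\infty)$ the dual of the one-point AG code obtained by evaluating $\mathcal L(\rho_\ell P_\infty)$ at the points of $\overline D$. The order bound (Feng-Rao designed minimum distance) is $d_{ORD}(C_\ell(P_\infty))=\min\{\nu_r\mid r\ge\ell\}$. *)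

theory Defs
  imports Complex_Main "HOL-Computational_Algebra.Polynomial" "HOL-Library.Infinite_Set"
begin

definition subfield_set :: "'f::field set \<Rightarrow> bool" where
  "subfield_set K \<longleftrightarrow> 0 \<in> K \<and> 1 \<in> K \<and>
     (\<forall>a\<in>K. \<forall>b\<in>K. a + b \<in> K \<and> a * b \<in> K) \<and>
     (\<forall>a\<in>K. - a \<in> K \<and> inverse a \<in> K)"

definition transcendental_over :: "'f::field set \<Rightarrow> 'f \<Rightarrow> bool" where
  "transcendental_over K t \<longleftrightarrow>
     (\<forall>p :: 'f poly. (\<forall>i. coeff p i \<in> K) \<and> poly p t = 0 \<longrightarrow> p = 0)"

text \<open>
  The type \<open>'f\<close> is the function field over \<open>K\<close> (the field with \<open>2 ^ (2 * n)\<close> elements) of the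
  irreducible curve \<open>X^2 + X = Y^3\<close>, \<open>Y^4 - Y = Z^m\<close>, with coordinate functions \<open>x, y, z\<close>. The
  curve has dimension one and \<open>x, y\<close> are algebraic over \<open>K(z)\<close>, so \<open>(x, y, z)\<close> is its generic
  point exactly when \<open>z\<close> is transcendental over \<open>K\<close>; this determines \<open>K(x, y, z)\<close> up to
  isomorphism. The nonsingular model enters through the places of this field.
\<close>

definition GGS_function_field ::
    "nat \<Rightarrow> nat \<Rightarrow> 'f::field set \<Rightarrow> 'f \<Rightarrow> 'f \<Rightarrow> 'f \<Rightarrow> bool" where
  "GGS_function_field n m K x y z \<longleftrightarrow>
     subfield_set K \<and> finite K \<and> card K = 2 ^ (2 * n) \<and>
     x ^ 2 + x = y ^ 3 \<and> y ^ 4 - y = z ^ m \<and>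
     transcendental_over K z \<and>
     subfield_set hull (K \<union> {x, y, z}) = UNIV"

text \<open>
  A place of the function field \<open>'f\<close> over \<open>K\<close>, i.e. a point of the nonsingular model, is
  represented by its valuation ring. A function has a pole at a place iff it lies outside that ring.
\<close>

definition place :: "'f::field set \<Rightarrow> 'f set \<Rightarrow> bool" where
  "place K V \<longleftrightarrow> K \<subset> V \<and> V \<noteq> UNIV \<and>
     (\<forall>a\<in>V. \<forall>b\<in>V. a - b \<in> V \<and> a * b \<in> V) \<and>
     (\<forall>a. a \<in> V \<or> inverse a \<in> V)"

definition place_units :: "'f::field set \<Rightarrow> 'f set" where
  "place_units V = {u \<in> V. u \<noteq> 0 \<and> inverse u \<in> V}"

definition prime_element :: "'f::field set \<Rightarrow> 'f \<Rightarrow> bool" where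
  "prime_element V t \<longleftrightarrow> V - place_units V = {t * a | a. a \<in> V}"

text \<open>The discrete valuation at a place, meaningful for nonzero arguments only.\<close>

definition place_val :: "'f::field set \<Rightarrow> 'f \<Rightarrow> int" where
  "place_val V f =
     (THE v. \<exists>t u. prime_element V t \<and> u \<in> place_units V \<and> f = u * t powi v)"

definition place_at_infinity ::
    "'f::field set \<Rightarrow> 'f \<Rightarrow> 'f \<Rightarrow> 'f \<Rightarrow> 'f set \<Rightarrow> bool" where
  "place_at_infinity K x y z V \<longleftrightarrow> place K V \<and> (x \<notin> V \<or> y \<notin> V \<or> z \<notin> V)"

text \<open>
  The pole divisor of \<open>f\<close> is \<open>r P\<close> iff \<open>f\<close> has no pole away from \<open>P\<close> and has pole order \<open>r\<close> at \<open>P\<close>.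
  Applying \<^const>\<open>nat\<close> to the negated valuation gives pole order 0 whenever \<open>f\<close> is regular at \<open>P\<close>.
\<close>

definition weierstrass_semigroup :: "'f::field set \<Rightarrow> 'f set \<Rightarrow> nat set" where
  "weierstrass_semigroup K P =
     {r. \<exists>f. f \<noteq> 0 \<and> (\<forall>Q. place K Q \<and> Q \<noteq> P \<longrightarrow> f \<in> Q) \<and> nat (- place_val P f) = r}"

text \<open>
  The elements of \<open>H\<close> are numbered from 1, so that \<open>sg_rho H 1 = 0\<close> for a numerical semigroup,
  whereas \<^const>\<open>enumerate\<close> numbers from 0. Only indices \<open>l \<ge> 1\<close> are meaningful.
\<close>

definition sg_rho :: "nat set \<Rightarrow> nat \<Rightarrow> nat" where
  "sg_rho H l = enumerate H (l - 1)"

definition sg_nu :: "nat set \<Rightarrow> nat \<Rightarrow> nat" where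
  "sg_nu H l = card {(a, b). a \<in> H \<and> b \<in> H \<and> a + b = sg_rho H (l + 1)}"

text \<open>
  The order (Feng--Rao) bound of the dual one-point code \<open>C_l(P)\<close>; it is a function of the
  Weierstrass semigroup \<open>H\<close> at \<open>P\<close> and of the index \<open>l\<close>. The infimum is over a nonempty set of
  natural numbers, hence a minimum.
\<close>

definition d_ORD :: "nat set \<Rightarrow> nat \<Rightarrow> nat" where
  "d_ORD H l = (INF r\<in>{l..}. sg_nu H r)"

end

theory Submission
  imports Defs
begin

text \<open>
  With \<open>u = y\<^sup>2 + y\<close> the function field is a tower of three Artin--Schreier extensions of \<open>K(z)\<close>:
  \<open>u\<^sup>2 + u = z\<^sup>m\<close>, \<open>y\<^sup>2 + y = u\<close>, \<open>x\<^sup>2 + x = y\<^sup>3\<close>. At a pole of \<open>z\<close> the values of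
  \<open>z, u, y, x\<close> are \<open>-8, -4m, -2m, -3m\<close>, and since \<open>m\<close> is odd each generator has a value outside
  the value group of the previous field. Hence the value of \<open>a + \<theta> b\<close> is the minimum of those of
  \<open>a\<close> and \<open>\<theta> b\<close>, the pole is unique, and the functions \<open>K[x, y, z]\<close> have exactly the pole orders
  \<open>3im + 2jm + 8k\<close>.

  Conversely let \<open>f\<close> be regular away from the pole. Since every valuation ring containing
  \<open>K[x, y, z]\<close> contains \<open>f\<close>, all powers of \<open>f\<close> have a common denominator \<open>D\<close> in \<open>K[z]\<close>. In
  characteristic 2 the \<open>2\<^sup>k\<close>-th power of \<open>a + \<theta> b\<close> has as \<open>\<theta>\<close>-coordinate the \<open>2\<^sup>k\<close>-th power of
  \<open>b\<close>, so the coordinates of \<open>f\<close> inherit this property down the tower to \<open>K(z)\<close>. There the value at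
  the pole decides: after division with remainder the fractional part has positive value, and
  \<open>D\<close> times a high power of it could not be a nonzero polynomial. Hence \<open>f\<close> lies in \<open>K[x, y, z]\<close>.

  In a semigroup with \<open>g\<close> gaps at least \<open>s + 1 - 2g\<close> pairs sum to \<open>s\<close>. Here \<open>2g = 9m - 7\<close>, and for
  \<open>s = 9m + 8k\<close> the bound \<open>8(k + 1)\<close> is attained, so no later index has a smaller count.
\<close>

section \<open>Valuation rings avoiding an element\<close>

definition subring_set :: "'f::field set \<Rightarrow> bool" where
  "subring_set S \<longleftrightarrow> 1 \<in> S \<and> (\<forall>a\<in>S. \<forall>b\<in>S. a - b \<in> S \<and> a * b \<in> S)"

definition polys :: "'f::field set \<Rightarrow> 'f poly set" where
  "polys S = {p. \<forall>i. coeff p i \<in> S}"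

definition adjoin :: "'f::field set \<Rightarrow> 'f \<Rightarrow> 'f set" where
  "adjoin S u = {poly p u | p. p \<in> polys S}"

lemma polysI: "(\<And>i. coeff p i \<in> S) \<Longrightarrow> p \<in> polys S"
  by (simp add: polys_def)

lemma polysD: "p \<in> polys S \<Longrightarrow> coeff p i \<in> S"
  by (simp add: polys_def)

context
  fixes S :: "'f::field set"
  assumes S: "subring_set S"
begin

lemma subring_one: "1 \<in> S"
  and subring_diff: "a \<in> S \<Longrightarrow> b \<in> S \<Longrightarrow> a - b \<in> S"
  and subring_mult: "a \<in> S \<Longrightarrow> b \<in> S \<Longrightarrow> a * b \<in> S"
  using S by (auto simp: subring_set_def)

lemma subring_zero: "0 \<in> S"
  using subring_diff[OF subring_one subring_one] by simp

lemma subring_uminus: "a \<in> S \<Longrightarrow> - a \<in> S"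
  using subring_diff[OF subring_zero, of a] by simp

lemma subring_add: "a \<in> S \<Longrightarrow> b \<in> S \<Longrightarrow> a + b \<in> S"
  using subring_diff[OF _ subring_uminus, of a b] by simp

lemma subring_power: "a \<in> S \<Longrightarrow> a ^ k \<in> S"
  by (induction k) (auto intro: subring_one subring_mult)

lemma subring_sum: "(\<And>i. i \<in> I \<Longrightarrow> h i \<in> S) \<Longrightarrow> sum h I \<in> S"
  by (induction I rule: infinite_finite_induct) (auto intro: subring_zero subring_add)

lemma poly_in_subring: "p \<in> polys S \<Longrightarrow> u \<in> S \<Longrightarrow> poly p u \<in> S"
  by (simp add: poly_altdef polys_def subring_sum subring_mult subring_power)

lemma subring_adjoin: "subring_set (adjoin S u)"
proof -
  have "1 \<in> polys S"
    by (simp add: polys_def coeff_1 subring_one subring_zero)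
  moreover have "1 = poly 1 u" by simp
  ultimately have "1 \<in> adjoin S u"
    unfolding adjoin_def by blast
  moreover have "poly p u - poly q u \<in> adjoin S u \<and> poly p u * poly q u \<in> adjoin S u"
    if "p \<in> polys S" "q \<in> polys S" for p q
  proof -
    have "p - q \<in> polys S" "p * q \<in> polys S"
      using that by (simp_all add: polys_def coeff_mult subring_diff subring_sum subring_mult)
    moreover have "poly p u - poly q u = poly (p - q) u" "poly p u * poly q u = poly (p * q) u"
      by simp_all
    ultimately show ?thesis
      unfolding adjoin_def by blast
  qed
  ultimately show ?thesis
    unfolding subring_set_def adjoin_def by blast
qed

lemma adjoin_superset: "S \<subseteq> adjoin S u"
proof
  fix a assume "a \<in> S"
  then have "[:a:] \<in> polys S"
    by (simp add: polys_def coeff_pCons subring_zero split: nat.split)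
  moreover have "a = poly [:a:] u" by simp
  ultimately show "a \<in> adjoin S u"
    unfolding adjoin_def by blast
qed

lemma adjoin_gen: "u \<in> adjoin S u"
proof -
  have "[:0, 1:] \<in> polys S"
    by (simp add: polys_def coeff_pCons subring_zero subring_one split: nat.split)
  moreover have "u = poly [:0, 1:] u" by simp
  ultimately show ?thesis
    unfolding adjoin_def by blast
qed

text \<open>Multiplying a polynomial in \<open>1 / b\<close> by \<open>b ^ degree p\<close> reverses
  its coefficients and leaves a polynomial in \<open>b\<close>.\<close>

lemma adjoin_inverse_mult_power:
  assumes "h \<in> adjoin S (inverse b)" "b \<in> S" "b \<noteq> 0"
  shows "\<exists>N. h * b ^ N \<in> S"
proof -
  obtain p where p: "p \<in> polys S" "h = poly p (inverse b)"
    using assms by (auto simp: adjoin_def)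
  then have "h * b ^ degree p = poly (reflect_poly p) b"
    by (simp add: poly_reflect_poly_nz assms)
  moreover have "reflect_poly p \<in> polys S"
    using p by (simp add: polys_def coeff_reflect_poly subring_zero)
  ultimately show ?thesis
    using poly_in_subring[OF _ assms(2)] by metis
qed

end

text \<open>A subring \<open>V\<close> maximal among those containing \<open>1 / f\<close> but not \<open>f\<close> is a valuation ring.\<close>

locale maximal_avoiding =
  fixes V :: "'f::field set" and f :: 'f
  assumes V: "subring_set V" and f_notin: "f \<notin> V" and inv_in: "inverse f \<in> V"
    and maximal: "\<And>W. subring_set W \<Longrightarrow> V \<subseteq> W \<Longrightarrow> f \<notin> W \<Longrightarrow> W = V"
begin

lemma f_nz: "f \<noteq> 0"
  using f_notin subring_zero[OF V] by metis

lemma f_in_adjoin: "h \<notin> V \<Longrightarrow> f \<in> adjoin V h"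
  using maximal[OF subring_adjoin[OF V, of h] adjoin_superset[OF V]] adjoin_gen[OF V] by metis

text \<open>The ideal of \<open>V\<close> generated by \<open>1 / f\<close>; it is proper because
  \<open>f\<close> is missing from \<open>V\<close>.\<close>

abbreviation J where "J \<equiv> {inverse f * a | a. a \<in> V}"

lemma J_subset: "J \<subseteq> V"
  using subring_mult[OF V inv_in] by blast

lemma J_add: "a \<in> J \<Longrightarrow> b \<in> J \<Longrightarrow> a + b \<in> J"
  using subring_add[OF V] by (smt (verit, ccfv_SIG) mem_Collect_eq distrib_left)

lemma J_mult: "a \<in> V \<Longrightarrow> b \<in> J \<Longrightarrow> a * b \<in> J"
  using subring_mult[OF V] by (smt (verit, ccfv_SIG) mem_Collect_eq mult.left_commute)

lemma J_zero: "0 \<in> J"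
  using subring_zero[OF V] by force

lemma one_notin_J: "1 \<notin> J"
proof
  assume "1 \<in> J"
  then obtain a where "a \<in> V" "1 = inverse f * a" by blast
  then have "a = f" using f_nz by (simp add: field_simps)
  then show False using \<open>a \<in> V\<close> f_notin by simp
qed

text \<open>Otherwise maximality puts \<open>f\<close> into \<open>V[1 / (1 - a)]\<close>, so
  \<open>f * (1 - a) ^ N\<close> lies in \<open>V\<close>. Since \<open>(1 - a) ^ N\<close> is 1
  modulo \<open>J\<close>, this product differs from \<open>f\<close> by an element of
  \<open>V\<close>, a contradiction.\<close>

lemma one_minus_J_unit:
  assumes "a \<in> J"
  shows "1 - a \<noteq> 0" "inverse (1 - a) \<in> V"
proof -
  show nz: "1 - a \<noteq> 0"
    using assms one_notin_J by auto
  have bV: "1 - a \<in> V"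
    using assms J_subset subring_diff[OF V subring_one[OF V]] by blast
  have pw: "1 - (1 - a) ^ N \<in> J" for N
  proof (induction N)
    case 0
    then show ?case using J_zero by simp
  next
    case (Suc N)
    have "1 - (1 - a) ^ Suc N = (1 - a) * (1 - (1 - a) ^ N) + a"
      by (simp add: algebra_simps)
    then show ?case
      using J_add[OF J_mult[OF bV Suc] assms] by simp
  qed
  show "inverse (1 - a) \<in> V"
  proof (rule ccontr)
    assume "inverse (1 - a) \<notin> V"
    from f_in_adjoin[OF this] obtain N where N: "f * (1 - a) ^ N \<in> V"
      using adjoin_inverse_mult_power[OF V _ bV nz] by blast
    obtain c where c: "c \<in> V" "1 - (1 - a) ^ N = inverse f * c"
      using pw by blast
    have "(1 - a) ^ N = 1 - inverse f * c"
      using c(2) by (simp add: algebra_simps)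
    then have "f = f * (1 - a) ^ N + c"
      using f_nz by (simp add: right_diff_distrib)
    then show False
      using subring_add[OF V N c(1)] f_notin by simp
  qed
qed

text \<open>The relation for \<open>1 / u\<close> expresses a power of \<open>u\<close> by lower
  powers with coefficients in \<open>J\<close>; substituting this in the leading term of
  \<open>p\<close> lowers the degree.\<close>

lemma reduce_relation:
  assumes p: "p \<in> polys J" "poly p u = 1" and q: "q \<in> polys J" "poly q (inverse u) = 1"
    and u: "u \<noteq> 0" and le: "degree q \<le> degree p"
  shows "\<exists>p'\<in>polys J. poly p' u = 1 \<and> degree p' < degree p"
proof -
  obtain q0 q1 where qq: "q = pCons q0 q1" by (cases q)
  have q0: "q0 \<in> J" using polysD[OF q(1), of 0] qq by simp
  have q1: "coeff q1 i \<in> J" for i using polysD[OF q(1), of "Suc i"] qq by simp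
  \<comment> \<open>Since \<open>1 - q0\<close> is a unit of \<open>V\<close>, the relation for
    \<open>1 / u\<close> can be normalised to \<open>u = r (1 / u)\<close>.\<close>
  define s where "s = inverse (1 - q0)"
  have s: "s \<in> V" "1 - q0 \<noteq> 0" using one_minus_J_unit[OF q0] s_def by auto
  define r where "r = smult s q1"
  have r: "coeff r i \<in> J" for i unfolding r_def using J_mult[OF s(1) q1] by simp
  have "inverse u * poly q1 (inverse u) = 1 - q0"
    using q(2) qq by (simp add: algebra_simps)
  then have r1: "poly r (inverse u) = u"
    using s(2) u by (simp add: r_def s_def field_simps)
  have q1_nz: "q1 \<noteq> 0"
    using q q0 one_notin_J qq by auto
  have s_nz: "s \<noteq> 0" using s s_def by simp
  have deg: "degree r + 1 \<le> degree p"
    using le q1_nz s_nz qq by (simp add: r_def)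
  have upow: "u ^ (degree r + 1) = poly (reflect_poly r) u"
    using r1 u by (simp add: poly_reflect_poly_nz)
  define d where "d = degree p"
  define c where "c = coeff p d"
  \<comment> \<open>The top term \<open>c * u ^ d\<close> becomes \<open>c * u ^ e\<close> times the
    reversed \<open>r\<close>, of total degree at most \<open>e + degree r = d - 1\<close>.\<close>
  define e where "e = d - (degree r + 1)"
  have de: "d = e + (degree r + 1)" using deg d_def e_def by simp
  define p' where "p' = p - monom c d + monom c e * reflect_poly r"
  have cJ: "c \<in> J" using polysD[OF p(1)] c_def by simp
  have cV: "c \<in> V" using cJ J_subset by blast
  have rr: "coeff (reflect_poly r) i \<in> J" for i
    using r J_zero by (simp add: coeff_reflect_poly)
  have "p' \<in> polys J"
  proof (rule polysI)
    fix i
    have "coeff (p - monom c d) i \<in> J"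
      using polysD[OF p(1), of i] J_zero by (auto simp: c_def)
    moreover have "coeff (monom c e * reflect_poly r) i \<in> J"
      using J_mult[OF cV rr] J_zero by (simp add: coeff_monom_mult)
    ultimately show "coeff p' i \<in> J"
      unfolding p'_def coeff_add by (rule J_add)
  qed
  moreover have "poly p' u = 1"
  proof -
    have "poly p' u = poly p u - c * u ^ d + c * u ^ e * u ^ (degree r + 1)"
      by (simp only: p'_def poly_add poly_diff poly_mult poly_monom upow)
    also have "c * u ^ e * u ^ (degree r + 1) = c * u ^ d"
      by (simp add: de power_add)
    finally show ?thesis using p(2) by simp
  qed
  moreover have "degree p' < degree p"
  proof -
    have "coeff p' i = 0" if "i \<ge> d" for i
    proof -
      have "coeff (p - monom c d) i = 0"
        using that coeff_eq_0[of p i] by (auto simp: c_def d_def le_less)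
      moreover have "coeff (monom c e * reflect_poly r) i = 0"
        using that de by (auto simp: coeff_monom_mult coeff_reflect_poly)
      ultimately show ?thesis by (simp add: p'_def)
    qed
    moreover have "d > 0" using deg d_def by simp
    ultimately have "degree p' < d"
      by (metis leading_coeff_0_iff degree_0 not_le)
    then show ?thesis by (simp add: d_def)
  qed
  ultimately show ?thesis by blast
qed

text \<open>Descent on the sum of the degrees: the relation of larger degree can always be
  shortened, after exchanging \<open>u\<close> and \<open>1 / u\<close> if necessary.\<close>

lemma no_two_relations:
  assumes "p \<in> polys J" "poly p u = 1" "q \<in> polys J" "poly q (inverse u) = 1" "u \<noteq> 0"
  shows False
  using assms
proof (induction "degree p + degree q" arbitrary: p q rule: less_induct)
  case less
  show ?case
  proof (cases "degree q \<le> degree p")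
    case True
    then obtain p' where "p' \<in> polys J" "poly p' u = 1" "degree p' < degree p"
      using reduce_relation[OF less.prems] by blast
    then show ?thesis
      using less.hyps[of p' q] less.prems by simp
  next
    case False
    then have "degree p \<le> degree q" by simp
    then obtain q' where "q' \<in> polys J" "poly q' (inverse u) = 1" "degree q' < degree q"
      using reduce_relation[of q "inverse u" p] less.prems by auto
    then show ?thesis
      using less.hyps[of p q'] less.prems by simp
  qed
qed

text \<open>By maximality \<open>f\<close> is a polynomial in \<open>u\<close> over
  \<open>V\<close>; dividing by \<open>f\<close> moves the coefficients into
  \<open>J\<close>.\<close>

lemma relation_of_notin:
  assumes "u \<notin> V"
  shows "\<exists>p\<in>polys J. poly p u = 1"
proof -
  obtain p where p: "p \<in> polys V" "f = poly p u"
    using f_in_adjoin[OF assms] by (auto simp: adjoin_def)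
  have "smult (inverse f) p \<in> polys J"
    by (rule polysI) (use polysD[OF p(1)] in auto)
  moreover have "poly (smult (inverse f) p) u = 1"
    using p f_nz by simp
  ultimately show ?thesis by blast
qed

lemma valuation_ring: "u \<in> V \<or> inverse u \<in> V"
proof (cases "u = 0")
  case True
  then show ?thesis using subring_zero[OF V] by simp
next
  case False
  then show ?thesis
    using relation_of_notin[of u] relation_of_notin[of "inverse u"] no_two_relations by blast
qed

end

text \<open>The hypothesis puts \<open>A[1 / f]\<close> among the subrings omitting
  \<open>f\<close>, so Zorn's lemma yields a maximal one. Contrapositively, an element of every
  valuation ring above \<open>A\<close> lies in \<open>A[1 / f]\<close>, which amounts to an
  integral equation over \<open>A\<close>.\<close>

lemma valuation_ring_avoiding:
  assumes A: "subring_set A" and f: "f \<notin> adjoin A (inverse f)"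
  shows "\<exists>V. subring_set V \<and> A \<subseteq> V \<and> f \<notin> V \<and> (\<forall>u. u \<in> V \<or> inverse u \<in> V)"
proof -
  let ?B = "adjoin A (inverse f)"
  let ?Z = "{S. subring_set S \<and> ?B \<subseteq> S \<and> f \<notin> S}"
  have "\<exists>M\<in>?Z. \<forall>X\<in>?Z. M \<subseteq> X \<longrightarrow> X = M"
  proof (rule subset_Zorn_nonempty)
    show "?Z \<noteq> {}" using subring_adjoin[OF A] f by blast
  next
    fix C assume C: "C \<noteq> {}" "subset.chain ?Z C"
    have CZ: "C \<subseteq> ?Z" and lin: "\<And>X Y. X \<in> C \<Longrightarrow> Y \<in> C \<Longrightarrow> X \<subseteq> Y \<or> Y \<subseteq> X"
      using C(2) by (auto simp: subset_chain_def)
    have "a - b \<in> \<Union>C \<and> a * b \<in> \<Union>C" if "a \<in> \<Union>C" "b \<in> \<Union>C" for a b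
    proof -
      from that obtain X Y where XY: "X \<in> C" "Y \<in> C" "a \<in> X" "b \<in> Y" by blast
      then obtain W where W: "W \<in> C" "a \<in> W" "b \<in> W" using lin by blast
      then have "subring_set W" using CZ by blast
      then show ?thesis using W by (auto simp: subring_set_def)
    qed
    moreover have "1 \<in> \<Union>C"
      using C(1) CZ subring_one by blast
    moreover have "?B \<subseteq> \<Union>C" "f \<notin> \<Union>C"
      using C(1) CZ by blast+
    ultimately show "\<Union>C \<in> ?Z"
      by (simp add: subring_set_def)
  qed
  then obtain V where VZ: "V \<in> ?Z" and max: "\<forall>X\<in>?Z. V \<subseteq> X \<longrightarrow> X = V"
    by (rule bexE)
  from VZ have VP: "subring_set V" "?B \<subseteq> V" "f \<notin> V" by simp_all
  interpret maximal_avoiding V f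
  proof
    show "inverse f \<in> V" using VP(2) adjoin_gen[OF A] by blast
    show "W = V" if "subring_set W" "V \<subseteq> W" "f \<notin> W" for W
      using bspec[OF max, of W] that VP(2) by simp
  qed (use VP in auto)
  show ?thesis
    using VP adjoin_superset[OF A] valuation_ring by blast
qed

section \<open>Values at a pole of z\<close>

lemma subfield_subring: "subfield_set K \<Longrightarrow> subring_set K"
  unfolding subfield_set_def subring_set_def
  by (metis ab_group_add_class.ab_diff_conv_add_uminus)

text \<open>As \<open>z\<close> has value \<open>-8\<close> at its pole, this fixes the value of \<open>f\<close> without a prime element.\<close>

definition has_val :: "'f::field \<Rightarrow> 'f set \<Rightarrow> 'f \<Rightarrow> int \<Rightarrow> bool" where
  "has_val z P f v \<longleftrightarrow> f \<noteq> 0 \<and> f ^ 8 * z powi v \<in> place_units P"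

section \<open>Valuation rings and values relative to \<open>z\<close>\<close>

context
  fixes K P :: "'f::field set"
  assumes K: "subfield_set K" and P: "place K P"
begin

lemma place_subring: "subring_set P"
  using P K by (auto simp: place_def subring_set_def subfield_set_def)

lemmas place_one = subring_one[OF place_subring]
  and place_zero = subring_zero[OF place_subring]
  and place_mult = subring_mult[OF place_subring]
  and place_diff = subring_diff[OF place_subring]
  and place_power = subring_power[OF place_subring]

lemma place_inverse: "a \<notin> P \<Longrightarrow> inverse a \<in> P"
  using P by (auto simp: place_def)

lemma field_subset_place: "a \<in> K \<Longrightarrow> a \<in> P"
  using P by (auto simp: place_def)

lemma units_mult: "a \<in> place_units P \<Longrightarrow> b \<in> place_units P \<Longrightarrow> a * b \<in> place_units P"
  using place_mult[of a b] place_mult[of "inverse a" "inverse b"]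
  by (simp add: place_units_def)

lemma units_inverse: "a \<in> place_units P \<Longrightarrow> inverse a \<in> place_units P"
  by (auto simp: place_units_def)

lemma units_power: "a \<in> place_units P \<Longrightarrow> a ^ n \<in> place_units P"
  using place_power[of a n] place_power[of "inverse a" n]
  by (simp add: place_units_def power_inverse)

text \<open>If \<open>a\<close> is outside \<open>P\<close>, then \<open>1 / a\<close> is inside,
  and \<open>a = a ^ n * (1 / a) ^ (n - 1)\<close>.\<close>

lemma power_in_place:
  assumes "a ^ n \<in> P" "n > 0"
  shows "a \<in> P"
proof (rule ccontr)
  assume a: "a \<notin> P"
  have "inverse a ^ (n - 1) \<in> P" by (intro place_power place_inverse a)
  then have "a ^ n * inverse a ^ (n - 1) \<in> P" by (intro place_mult assms)
  moreover have "a \<noteq> 0" using a place_zero by metis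
  then have "a ^ n * inverse a ^ (n - 1) = a"
    using assms(2) by (cases n) (simp_all add: power_inverse)
  ultimately show False using a by simp
qed

lemma units_root:
  assumes "a ^ n \<in> place_units P" "n > 0"
  shows "a \<in> place_units P"
  using assms power_in_place[of a n] power_in_place[of "inverse a" n]
  by (auto simp: place_units_def power_inverse)

text \<open>Here \<open>h\<close> lies in the maximal ideal. If \<open>h / (1 + h)\<close> were
  outside \<open>P\<close>, its inverse \<open>1 + 1 / h\<close> would be inside, and with it
  \<open>1 / h\<close>. The inverse of \<open>1 + h\<close> is
  \<open>1 - h / (1 + h)\<close>.\<close>

lemma one_plus_unit:
  assumes "h \<in> P" "inverse h \<notin> P"
  shows "1 + h \<in> place_units P"
proof -
  have nz: "1 + h \<noteq> 0"
  proof
    assume "1 + h = 0"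
    then have "h = - 1" by (simp add: eq_neg_iff_add_eq_0 add.commute)
    then have "inverse h = h" by simp
    then show False using assms by simp
  qed
  have hnz: "h \<noteq> 0" using assms place_zero by auto
  have "h * inverse (1 + h) \<in> P"
  proof (rule ccontr)
    assume "h * inverse (1 + h) \<notin> P"
    from place_inverse[OF this] have "(1 + h) * inverse h \<in> P"
      by (simp add: mult.commute)
    moreover have "(1 + h) * inverse h = 1 + inverse h"
      using hnz by (simp add: field_simps)
    ultimately have "(1 + inverse h) - 1 \<in> P"
      using place_diff[OF _ place_one, of "1 + inverse h"] by simp
    then show False using assms by simp
  qed
  then have "1 - h * inverse (1 + h) \<in> P" by (rule place_diff[OF place_one])
  moreover have "1 - h * inverse (1 + h) = inverse (1 + h)"
    using nz by (simp add: field_simps)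
  ultimately show ?thesis
    using nz subring_add[OF place_subring place_one assms(1)] by (simp add: place_units_def)
qed

text \<open>At a pole of \<theta> the reciprocal is regular, and \<theta> is
  \<open>(\<theta> ^ 2 + \<theta>) / \<theta> - 1\<close>.\<close>

lemma artin_schreier_in_place:
  assumes "\<theta>\<^sup>2 + \<theta> \<in> P"
  shows "\<theta> \<in> P"
proof (rule ccontr)
  assume n: "\<theta> \<notin> P"
  then have "(\<theta>\<^sup>2 + \<theta>) * inverse \<theta> - 1 \<in> P"
    by (intro place_diff place_mult place_one place_inverse n assms)
  moreover have "\<theta> \<noteq> 0" using n place_zero by metis
  then have "(\<theta>\<^sup>2 + \<theta>) * inverse \<theta> - 1 = \<theta>"
    by (simp add: field_simps power2_eq_square)
  ultimately show False using n by simp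
qed

lemma has_val_mult: "has_val z P f v \<Longrightarrow> has_val z P g w \<Longrightarrow> z \<noteq> 0 \<Longrightarrow> has_val z P (f * g) (v + w)"
  using units_mult[of "f ^ 8 * z powi v" "g ^ 8 * z powi w"]
  by (simp add: has_val_def power_int_add power_mult_distrib mult_ac)

lemma has_val_inverse: "has_val z P f v \<Longrightarrow> has_val z P (inverse f) (- v)"
  using units_inverse[of "f ^ 8 * z powi v"]
  by (simp add: has_val_def power_int_minus power_inverse)

lemma has_val_unit: "u \<in> place_units P \<Longrightarrow> has_val z P u 0"
  using units_power by (auto simp: has_val_def place_units_def)

context
  fixes z assumes z: "z \<notin> P"
begin

lemma pole_nz: "z \<noteq> 0"
  using z place_zero by metis

lemma powi_in_place_iff: "z powi v \<in> P \<longleftrightarrow> v \<le> 0"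
proof (cases "v \<le> 0")
  case True
  then have "z powi v = inverse z ^ nat (- v)"
    by (auto simp: power_int_def power_inverse)
  then show ?thesis using True place_power[OF place_inverse[OF z]] by simp
next
  case False
  then have "z powi v = z ^ nat v" "nat v > 0"
    by (auto simp: power_int_def)
  then show ?thesis using False z power_in_place[of z "nat v"] by auto
qed

lemma powi_unit_iff: "z powi v \<in> place_units P \<longleftrightarrow> v = 0"
proof -
  have "inverse (z powi v) = z powi (- v)" by (simp add: power_int_minus)
  then show ?thesis
    using powi_in_place_iff[of v] powi_in_place_iff[of "- v"] pole_nz
    by (auto simp: place_units_def)
qed

lemma has_val_unique:
  assumes "has_val z P f v" "has_val z P f w"
  shows "v = w"
proof -
  have "(f ^ 8 * z powi v) * inverse (f ^ 8 * z powi w) \<in> place_units P"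
    by (rule units_mult[OF _ units_inverse]) (use assms in \<open>simp_all add: has_val_def\<close>)
  moreover have "(f ^ 8 * z powi v) * inverse (f ^ 8 * z powi w) = z powi (v - w)"
    using assms(1) pole_nz by (simp add: has_val_def field_simps power_int_diff)
  ultimately show ?thesis using powi_unit_iff by simp
qed

lemma has_val_in_place_iff:
  assumes "has_val z P f v"
  shows "f \<in> P \<longleftrightarrow> v \<ge> 0"
proof -
  define u where "u = f ^ 8 * z powi v"
  have u: "u \<in> P" "inverse u \<in> P" using assms by (auto simp: u_def has_val_def place_units_def)
  have nz: "f \<noteq> 0" using assms by (simp add: has_val_def)
  have 1: "f ^ 8 = u * z powi (- v)" and 2: "z powi (- v) = f ^ 8 * inverse u"
    using nz pole_nz by (auto simp: u_def field_simps power_int_minus)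
  show ?thesis
  proof
    assume "f \<in> P"
    then have "z powi (- v) \<in> P" unfolding 2 by (intro place_mult place_power u)
    then show "v \<ge> 0" using powi_in_place_iff by simp
  next
    assume "v \<ge> 0"
    then have "z powi (- v) \<in> P" using powi_in_place_iff by simp
    then have "f ^ 8 \<in> P" unfolding 1 by (intro place_mult u)
    then show "f \<in> P" using power_in_place[of f 8] by simp
  qed
qed

lemma has_val_unit_iff:
  assumes "has_val z P f v"
  shows "f \<in> place_units P \<longleftrightarrow> v = 0"
  using assms has_val_in_place_iff[OF assms] has_val_in_place_iff[OF has_val_inverse[OF assms]]
  by (auto simp: place_units_def has_val_def)

lemma has_val_gen: "has_val z P z (- 8)"
  using pole_nz place_one by (simp add: has_val_def power_int_minus place_units_def)

text \<open>In \<open>f + g = f * (1 + g / f)\<close> the quotient \<open>g / f\<close> has positive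
  value, so the second factor is a unit.\<close>

lemma has_val_add:
  assumes f: "has_val z P f v" and g: "has_val z P g w" and "v < w"
  shows "has_val z P (f + g) v"
proof -
  define h where "h = g * inverse f"
  have h: "has_val z P h (w - v)"
    using has_val_mult[OF g has_val_inverse[OF f] pole_nz] by (simp add: h_def)
  have "h \<in> P" "inverse h \<notin> P"
    using has_val_in_place_iff[OF h] has_val_in_place_iff[OF has_val_inverse[OF h]] assms(3) by auto
  then have "has_val z P (1 + h) 0"
    by (intro has_val_unit one_plus_unit)
  from has_val_mult[OF f this pole_nz] show ?thesis
    using f by (simp add: h_def has_val_def field_simps)
qed

text \<open>A pole of \<open>\<theta> ^ 2 + \<theta>\<close> is a pole of \<theta>, so
  \<open>1 + 1 / \<theta>\<close> is a unit there and \<open>\<theta> ^ 2\<close> has the value of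
  \<open>\<theta> ^ 2 + \<theta>\<close>. Roots of units are units, which allows halving.\<close>

lemma has_val_artin_schreier:
  assumes c: "has_val z P (\<theta>\<^sup>2 + \<theta>) (2 * v)" and "v < 0"
  shows "has_val z P \<theta> v"
proof -
  have "\<theta>\<^sup>2 + \<theta> \<notin> P" using has_val_in_place_iff[OF c] assms(2) by simp
  then have th: "\<theta> \<notin> P"
    using subring_add[OF place_subring place_power] by blast
  then have nz: "\<theta> \<noteq> 0" using place_zero by metis
  define e where "e = 1 + inverse \<theta>"
  have e: "e \<in> place_units P"
    unfolding e_def using th place_inverse[OF th] by (intro one_plus_unit) auto
  have eq: "\<theta>\<^sup>2 + \<theta> = \<theta>\<^sup>2 * e"
    using nz by (simp add: e_def field_simps power2_eq_square)
  have enz: "e \<noteq> 0" using e by (simp add: place_units_def)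
  have "(\<theta>\<^sup>2 * e) ^ 8 * z powi (2 * v) * inverse (e ^ 8) \<in> place_units P"
    by (rule units_mult[OF _ units_inverse[OF units_power[OF e]]])
      (use c in \<open>simp add: has_val_def eq\<close>)
  moreover have "(\<theta>\<^sup>2 * e) ^ 8 * z powi (2 * v) * inverse (e ^ 8) = (\<theta> ^ 8 * z powi v) ^ 2"
  proof -
    have "z powi (2 * v) = z powi v * z powi v"
      using pole_nz by (simp add: power_int_add[symmetric])
    moreover have "e ^ 8 * inverse (e ^ 8) = 1" using enz by simp
    ultimately show ?thesis
      by (simp add: power_mult_distrib power2_eq_square mult_ac)
  qed
  ultimately have "\<theta> ^ 8 * z powi v \<in> place_units P"
    using units_root[of "\<theta> ^ 8 * z powi v" 2] by simp
  then show ?thesis using nz by (simp add: has_val_def)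
qed

text \<open>In Horner's form \<open>a + z * q(z)\<close> a nonzero constant has value 0, and
  \<open>z * q(z)\<close> has a strictly smaller value.\<close>

lemma has_val_poly:
  assumes "p \<in> polys K" "p \<noteq> 0"
  shows "has_val z P (poly p z) (- 8 * int (degree p))"
  using assms
proof (induction p rule: pCons_induct)
  case 0
  then show ?case by simp
next
  case (pCons a q)
  have a: "a \<in> K" using polysD[OF pCons.prems(1), of 0] by simp
  have q: "q \<in> polys K"
    using polysD[OF pCons.prems(1), of "Suc i" for i] by (intro polysI) simp
  have const: "has_val z P a 0" if "a \<noteq> 0"
  proof (rule has_val_unit)
    show "a \<in> place_units P"
      using that a K field_subset_place by (auto simp: place_units_def subfield_set_def)
  qed
  show ?case
  proof (cases "q = 0")
    case True
    then show ?thesis using const pCons.prems by simp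
  next
    case False
    have zq: "has_val z P (z * poly q z) (- 8 + - 8 * int (degree q))"
      using has_val_mult[OF has_val_gen pCons.IH[OF q False] pole_nz] .
    show ?thesis
    proof (cases "a = 0")
      case True
      then show ?thesis using zq False by (simp add: algebra_simps)
    next
      case anz: False
      have "has_val z P (z * poly q z + a) (- 8 + - 8 * int (degree q))"
        by (rule has_val_add[OF zq const[OF anz]]) simp
      then show ?thesis using False by (simp add: algebra_simps)
    qed
  qed
qed

end

end

section \<open>Division with remainder over the subfield\<close>

text \<open>Quotient and remainder must keep their coefficients in \<open>K\<close>, so the division
  is built up one coefficient of \<open>p\<close> at a time.\<close>

lemma polys_div_mod:
  fixes K :: "'f::field set"
  assumes K: "subfield_set K" and q: "q \<in> polys K" "q \<noteq> 0" and p: "p \<in> polys K"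
  shows "\<exists>s\<in>polys K. \<exists>r\<in>polys K. p = s * q + r \<and> (r = 0 \<or> degree r < degree q)"
proof -
  note R = subfield_subring[OF K]
  note closed = subring_zero[OF R] subring_mult[OF R] subring_diff[OF R] subring_add[OF R]
  have "\<exists>s\<in>polys K. \<exists>r\<in>polys K. p = s * q + r \<and> (\<forall>i\<ge>degree q. coeff r i = 0)"
    using p
  proof (induction p rule: pCons_induct)
    case 0
    have "0 \<in> polys K" by (simp add: polys_def closed)
    then show ?case by force
  next
    case (pCons a p')
    have a: "a \<in> K" using polysD[OF pCons.prems, of 0] by simp
    have "p' \<in> polys K"
      using polysD[OF pCons.prems, of "Suc i" for i] by (intro polysI) simp
    from pCons.IH[OF this] obtain s r where sr: "s \<in> polys K" "r \<in> polys K" "p' = s * q + r"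
      "\<forall>i\<ge>degree q. coeff r i = 0" by blast
    \<comment> \<open>\<open>c\<close> cancels the coefficient of the shifted remainder at position
      \<open>degree q\<close>.\<close>
    define c where "c = coeff (pCons a r) (degree q) * inverse (lead_coeff q)"
    have c: "c \<in> K"
      unfolding c_def using K a sr(2) q(1) closed
      by (auto simp: coeff_pCons polys_def subfield_set_def split: nat.split)
    define s' where "s' = pCons c s"
    define r' where "r' = pCons a r - smult c q"
    have "s' \<in> polys K" "r' \<in> polys K"
      using sr(1,2) q(1) c a closed
      by (auto simp: s'_def r'_def polys_def coeff_pCons split: nat.split)
    moreover have "pCons a p' = s' * q + r'"
      by (simp add: s'_def r'_def sr(3) algebra_simps)
    moreover have "coeff r' i = 0" if "i \<ge> degree q" for i
    proof (cases "i = degree q")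
      case True
      then show ?thesis using q(2) by (simp add: r'_def c_def)
    next
      case False
      then have "i > degree q" using that by simp
      then obtain j where "i = Suc j" "j \<ge> degree q" by (cases i) auto
      then show ?thesis
        using sr(4) \<open>i > degree q\<close> by (simp add: r'_def coeff_eq_0)
    qed
    ultimately show ?case by blast
  qed
  then obtain s r where "s \<in> polys K" "r \<in> polys K" "p = s * q + r"
    and z: "\<forall>i\<ge>degree q. coeff r i = 0" by blast
  moreover have "r = 0 \<or> degree r < degree q"
    using z by (metis leading_coeff_0_iff not_le)
  ultimately show ?thesis by blast
qed

section \<open>Artin--Schreier towers in characteristic 2\<close>

locale char2_pole =
  fixes K :: "'f::field set" and z :: 'f
  assumes K: "subfield_set K" and char2: "a + a = (0::'f)"
    and pole_exists: "\<exists>P. place K P \<and> z \<notin> P"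
begin

lemma two_eq_zero [simp]: "(2::'f) = 0"
  using char2[of 1] by simp

lemma minus_eq [simp]: "- a = (a::'f)"
  using char2[of a] by (metis minus_unique)

lemma add_self_left [simp]: "(a::'f) + (a + b) = b"
  by (metis add.assoc add_0 char2)

lemma frobenius: "(a + b) ^ 2 ^ k = a ^ 2 ^ k + (b::'f) ^ 2 ^ k"
proof (induction k)
  case (Suc k)
  have "(c + d)\<^sup>2 = c\<^sup>2 + (d::'f)\<^sup>2" for c d
    using char2[of "c * d"] by (simp add: power2_eq_square algebra_simps)
  then show ?case
    by (simp only: power_Suc2 power_mult Suc)
qed simp

text \<open>The common value \<open>v\<close> of \<open>f\<close> at all poles of \<open>z\<close>. Quantifying over the poles shows later
  that there is only one of them.\<close>

definition pole_val :: "'f \<Rightarrow> int \<Rightarrow> bool" where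
  "pole_val f v \<longleftrightarrow> (\<forall>P. place K P \<and> z \<notin> P \<longrightarrow> has_val z P f v)"

lemma pole_valI: "(\<And>P. place K P \<Longrightarrow> z \<notin> P \<Longrightarrow> has_val z P f v) \<Longrightarrow> pole_val f v"
  by (simp add: pole_val_def)

lemma pole_valD: "pole_val f v \<Longrightarrow> place K P \<Longrightarrow> z \<notin> P \<Longrightarrow> has_val z P f v"
  by (simp add: pole_val_def)

lemma pole_val_mult: "pole_val f v \<Longrightarrow> pole_val g w \<Longrightarrow> pole_val (f * g) (v + w)"
  unfolding pole_val_def by (metis has_val_mult[OF K] pole_nz[OF K])

lemma pole_val_inverse: "pole_val f v \<Longrightarrow> pole_val (inverse f) (- v)"
  unfolding pole_val_def by (metis has_val_inverse[OF K])

lemma pole_val_add: "pole_val f v \<Longrightarrow> pole_val g w \<Longrightarrow> v < w \<Longrightarrow> pole_val (f + g) v"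
  unfolding pole_val_def by (metis has_val_add[OF K])

text \<open>A pole of \<open>z\<close> exists, so the quantifier in \<open>pole_val\<close> is not
  vacuous and uniqueness at one pole suffices.\<close>

lemma pole_val_unique: "pole_val f v \<Longrightarrow> pole_val f w \<Longrightarrow> v = w"
  using pole_exists by (meson pole_valD has_val_unique[OF K])

lemma pole_val_nz: "pole_val f v \<Longrightarrow> f \<noteq> 0"
  using pole_exists by (meson pole_valD has_val_def)

lemma pole_val_one: "pole_val 1 0"
  using has_val_unit[OF K] place_one[OF K] by (simp add: pole_valI place_units_def)

lemma pole_val_power: "pole_val f v \<Longrightarrow> pole_val (f ^ k) (int k * v)"
proof (induction k)
  case (Suc k)
  then show ?case
    using pole_val_mult[OF Suc.prems Suc.IH] by (simp add: algebra_simps)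
qed (simp add: pole_val_one)

lemma pole_val_gen: "pole_val z (- 8)"
  by (simp add: pole_valI has_val_gen[OF K])

lemma pole_val_artin_schreier:
  "pole_val (\<theta>\<^sup>2 + \<theta>) (2 * v) \<Longrightarrow> v < 0 \<Longrightarrow> pole_val \<theta> v"
  unfolding pole_val_def by (metis has_val_artin_schreier[OF K])

lemma pole_val_poly: "p \<in> polys K \<Longrightarrow> p \<noteq> 0 \<Longrightarrow> pole_val (poly p z) (- 8 * int (degree p))"
  by (rule pole_valI) (rule has_val_poly[OF K])

abbreviation R where "R \<equiv> adjoin K z"

lemma subring_R: "subring_set R"
  by (rule subring_adjoin[OF subfield_subring[OF K]])

lemma K_subset_R: "K \<subseteq> R" and z_in_R: "z \<in> R"
  using adjoin_superset[OF subfield_subring[OF K]] adjoin_gen[OF subfield_subring[OF K]] by simp_all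

lemma pole_val_R: "r \<in> R \<Longrightarrow> r \<noteq> 0 \<Longrightarrow> \<exists>d. pole_val r (- 8 * int d)"
proof -
  assume "r \<in> R" "r \<noteq> 0"
  then obtain p where "p \<in> polys K" "r = poly p z" unfolding adjoin_def by blast
  moreover from this \<open>r \<noteq> 0\<close> have "p \<noteq> 0" by (metis poly_0)
  ultimately show ?thesis using pole_val_poly by blast
qed

end

section \<open>Adjoining a root of an Artin-Schreier equation\<close>

text \<open>In the tower \<theta> is quadratic over \<open>E\<close>, so this module is already the
  ring \<open>E[\<theta>]\<close>.\<close>

definition adjoin2 :: "'f::field set \<Rightarrow> 'f \<Rightarrow> 'f set" where
  "adjoin2 E \<theta> = {a + \<theta> * b | a b. a \<in> E \<and> b \<in> E}"

lemma adjoin2I: "a \<in> E \<Longrightarrow> b \<in> E \<Longrightarrow> a + \<theta> * b \<in> adjoin2 E \<theta>"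
  by (auto simp: adjoin2_def)

lemma adjoin2E:
  assumes "f \<in> adjoin2 E \<theta>"
  obtains a b where "a \<in> E" "b \<in> E" "f = a + \<theta> * b"
  using assms by (auto simp: adjoin2_def)

lemma adjoin2_superset: "0 \<in> E \<Longrightarrow> E \<subseteq> adjoin2 E \<theta>"
  using adjoin2I[of _ E 0 \<theta>] by auto

lemma adjoin2_gen: "0 \<in> E \<Longrightarrow> 1 \<in> E \<Longrightarrow> \<theta> \<in> adjoin2 E \<theta>"
  using adjoin2I[of 0 E 1 \<theta>] by auto

lemma subfieldD:
  assumes "subfield_set E"
  shows "0 \<in> E" "1 \<in> E" "a \<in> E \<Longrightarrow> b \<in> E \<Longrightarrow> a + b \<in> E" "a \<in> E \<Longrightarrow> b \<in> E \<Longrightarrow> a * b \<in> E"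
    "a \<in> E \<Longrightarrow> inverse a \<in> E"
  using assms by (auto simp: subfield_set_def)

text \<open>
  One level of the tower: \<open>E\<close> is a field between \<open>K(z)\<close> and the whole function field and \<open>A\<close> its
  ring of functions regular away from the poles of \<open>z\<close>, with set of pole orders \<open>\<Gamma>\<close>. The axiom
  \<open>closed\<close> is a form of integral closedness adapted to characteristic 2.
\<close>

locale tower_level = char2_pole K z for K :: "'f::field set" and z +
  fixes E A :: "'f set" and d :: int and \<Gamma> :: "nat set"
  assumes E: "subfield_set E" and A: "subring_set A" and AE: "A \<subseteq> E" and RA: "R \<subseteq> A"
    and denominator: "f \<in> E \<Longrightarrow> \<exists>D\<in>R. D \<noteq> 0 \<and> D * f \<in> A"
    and field_value: "f \<in> E \<Longrightarrow> f \<noteq> 0 \<Longrightarrow> \<exists>v. d dvd v \<and> pole_val f v"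
    and pole_orders: "f \<in> A \<Longrightarrow> f \<noteq> 0 \<Longrightarrow> \<exists>s\<in>\<Gamma>. pole_val f (- int s)"
    and pole_orders_attained: "s \<in> \<Gamma> \<Longrightarrow> \<exists>f\<in>A. pole_val f (- int s)"
    and closed: "f \<in> E \<Longrightarrow> D \<in> R \<Longrightarrow> D \<noteq> 0 \<Longrightarrow> (\<And>k. D * f ^ 2 ^ k \<in> A) \<Longrightarrow> f \<in> A"

text \<open>\<open>K(z)\<close> with its subring \<open>K[z]\<close> starts the tower; values are
  multiples of 8 because \<open>z\<close> has value \<open>-8\<close>. Division with remainder
  reduces \<open>closed\<close> to the fractional part \<open>g\<close> of \<open>f\<close>.\<close>

lemma (in char2_pole) base_level:
  "tower_level K z {a * inverse b | a b. a \<in> R \<and> b \<in> R \<and> b \<noteq> 0} R 8 {8 * k | k. True}"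
    (is "tower_level K z ?E R 8 _")
proof -
  note R = subring_R
  have EI: "a * inverse b \<in> ?E" if "a \<in> R" "b \<in> R" "b \<noteq> 0" for a b
    using that by blast
  show ?thesis
  proof unfold_locales
    have zero: "0 \<in> ?E" and one: "1 \<in> ?E"
      using EI[OF subring_zero[OF R] subring_one[OF R]] EI[OF subring_one[OF R] subring_one[OF R]]
      by simp_all
    have add: "f + g \<in> ?E" if "f \<in> ?E" "g \<in> ?E" for f g
    proof -
      from that(1) obtain a b where f: "a \<in> R" "b \<in> R" "b \<noteq> 0" "f = a * inverse b" by blast
      from that(2) obtain c e where g: "c \<in> R" "e \<in> R" "e \<noteq> 0" "g = c * inverse e" by blast
      have "(a * e + c * b) * inverse (b * e) \<in> ?E"
        by (rule EI) (use f g in \<open>auto intro!: subring_add[OF R] subring_mult[OF R]\<close>)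
      moreover have "f + g = (a * e + c * b) * inverse (b * e)"
        using f g by (simp add: field_simps)
      ultimately show ?thesis by simp
    qed
    have mult: "f * g \<in> ?E" if "f \<in> ?E" "g \<in> ?E" for f g
    proof -
      from that(1) obtain a b where f: "a \<in> R" "b \<in> R" "b \<noteq> 0" "f = a * inverse b" by blast
      from that(2) obtain c e where g: "c \<in> R" "e \<in> R" "e \<noteq> 0" "g = c * inverse e" by blast
      have "(a * c) * inverse (b * e) \<in> ?E"
        by (rule EI) (use f g in \<open>auto intro!: subring_mult[OF R]\<close>)
      moreover have "f * g = (a * c) * inverse (b * e)"
        using f g by (simp add: field_simps)
      ultimately show ?thesis by simp
    qed
    have inv: "inverse f \<in> ?E" if "f \<in> ?E" for f
    proof -
      from that obtain a b where f: "a \<in> R" "b \<in> R" "b \<noteq> 0" "f = a * inverse b" by blast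
      show ?thesis
      proof (cases "a = 0")
        case True
        then show ?thesis using f zero by simp
      next
        case False
        then have "b * inverse a \<in> ?E" using EI f by blast
        then show ?thesis using f by (simp add: mult.commute)
      qed
    qed
    show "subfield_set ?E"
      unfolding subfield_set_def minus_eq
      by (intro conjI ballI) (assumption | rule zero one add mult inv)+
  next
    show "subring_set R" by (rule R)
    show "R \<subseteq> R" ..
    show "R \<subseteq> ?E" using EI[OF _ subring_one[OF R]] by auto
  next
    fix f assume "f \<in> ?E"
    then obtain a b where f: "a \<in> R" "b \<in> R" "b \<noteq> 0" "f = a * inverse b" by blast
    then have "b * f = a" by simp
    with f(1-3) show "\<exists>D\<in>R. D \<noteq> 0 \<and> D * f \<in> R" by metis
  next
    fix f assume "f \<in> ?E" "f \<noteq> 0"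
    then obtain a b where f: "a \<in> R" "b \<in> R" "b \<noteq> 0" "a \<noteq> 0" "f = a * inverse b" by auto
    obtain v w where "pole_val a (- 8 * int v)" "pole_val b (- 8 * int w)"
      using pole_val_R f by blast
    then have "pole_val f (- 8 * int v + - (- 8 * int w))"
      using pole_val_mult pole_val_inverse f by blast
    then show "\<exists>v. 8 dvd v \<and> pole_val f v"
      by (intro exI conjI) auto
  next
    fix f assume "f \<in> R" "f \<noteq> 0"
    then obtain k where "pole_val f (- 8 * int k)" using pole_val_R by blast
    then show "\<exists>s\<in>{8 * k | k. True}. pole_val f (- int s)"
      by (intro bexI[of _ "8 * k"]) auto
  next
    fix s :: nat assume "s \<in> {8 * k | k. True}"
    then obtain k where "s = 8 * k" by blast
    then show "\<exists>f\<in>R. pole_val f (- int s)"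
      using pole_val_power[OF pole_val_gen, of k] subring_power[OF R z_in_R, of k]
      by (intro bexI[of _ "z ^ k"]) (auto simp: mult.commute)
  next
    fix f D assume f: "f \<in> ?E" and D: "D \<in> R" "D \<noteq> 0" and Df: "\<And>k. D * f ^ 2 ^ k \<in> R"
    from f obtain a b where ab: "a \<in> R" "b \<in> R" "b \<noteq> 0" "f = a * inverse b" by blast
    from ab(1,2) obtain p q where p: "p \<in> polys K" "a = poly p z" and q: "q \<in> polys K" "b = poly q z"
      unfolding adjoin_def by blast
    have q0: "q \<noteq> 0" using q ab by auto
    obtain s r where s: "s \<in> polys K" and r: "r \<in> polys K" "p = s * q + r" "r = 0 \<or> degree r < degree q"
      using polys_div_mod[OF K q(1) q0 p(1)] by blast
    have sR: "poly s z \<in> R" using s unfolding adjoin_def by blast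
    define g where "g = poly r z * inverse b"
    have fg: "f = poly s z + g"
      using ab p q r(2) by (simp add: g_def field_simps)
    have "r = 0"
    proof (rule ccontr)
      assume "r \<noteq> 0"
      then have deg: "degree r < degree q" using r by simp
      define e where "e = 8 * int (degree q) - 8 * int (degree r)"
      have g: "pole_val g e"
        using pole_val_mult[OF pole_val_poly[OF r(1) \<open>r \<noteq> 0\<close>] pole_val_inverse[OF pole_val_poly[OF q(1) q0]]]
        by (simp add: g_def e_def q)
      obtain c where c: "pole_val D (- 8 * int c)" using pole_val_R D by blast
      \<comment> \<open>\<open>8 * c\<close> is the pole order of \<open>D\<close>. With this
        exponent \<open>D * g ^ 2 ^ k\<close> has value \<open>2 ^ k * e - k\<close>, which is
        positive, whereas nonzero elements of \<open>K[z]\<close> have value at most 0.\<close>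
      define k where "k = 8 * c"
      have Dg: "pole_val (D * g ^ 2 ^ k) (- 8 * int c + int (2 ^ k) * e)"
        by (intro pole_val_mult c pole_val_power g)
      have "D * g ^ 2 ^ k = D * f ^ 2 ^ k - D * poly s z ^ 2 ^ k"
        unfolding fg frobenius by (simp add: algebra_simps)
      then have "D * g ^ 2 ^ k \<in> R"
        using D sR
        by (simp only:) (intro subring_diff[OF R Df] subring_mult[OF R] subring_power[OF R])
      then obtain c' where "pole_val (D * g ^ 2 ^ k) (- 8 * int c')"
        using pole_val_R pole_val_nz[OF Dg] by blast
      from pole_val_unique[OF this Dg] have le: "int (2 ^ k) * e \<le> int k"
        by (simp add: k_def)
      have "e \<ge> 1" using deg by (simp add: e_def)
      then have "int (2 ^ k) * 1 \<le> int (2 ^ k) * e" by (intro mult_left_mono) auto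
      then have "int (2 ^ k) \<le> int k" using le by linarith
      then have "2 ^ k \<le> k" by (simp only: of_nat_le_iff)
      then show False using less_exp[of k] by simp
    qed
    then show "f \<in> R" using fg sR by (simp add: g_def)
  qed
qed

text \<open>The conditions on \<open>t\<close> put the value of \<theta> outside the multiples of
  \<open>d\<close>, to which all values on \<open>E\<close> belong, but inside those of
  \<open>d div 2\<close>: the step is ramified at the pole.\<close>

locale artin_schreier_step = tower_level K z E A d \<Gamma>
  for K :: "'f::field set" and z E A d \<Gamma> +
  fixes \<theta> :: 'f and t :: nat
  assumes d_even: "even d" and \<theta>: "\<theta>\<^sup>2 + \<theta> \<in> A"
    and t: "pole_val \<theta> (- int t)" "\<not> d dvd int t" "d div 2 dvd int t"
begin

definition c where "c = \<theta>\<^sup>2 + \<theta>"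

lemma c_in_A: "c \<in> A"
  using \<theta> by (simp add: c_def)

lemma theta_sq: "\<theta> * \<theta> = \<theta> + c"
  by (simp add: c_def power2_eq_square add.left_commute)

text \<open>For nonzero \<open>a\<close> and \<open>b\<close> the value of \<open>a\<close> is
  divisible by \<open>d\<close> and that of \<open>\<theta> * b\<close> is not, so they differ and
  the smaller one wins. The disjunction records which summand supplies the value.\<close>

lemma value_adjoin2:
  assumes "a \<in> E" "b \<in> E" "a \<noteq> 0 \<or> b \<noteq> 0"
  shows "\<exists>v. pole_val (a + \<theta> * b) v \<and> (a \<noteq> 0 \<and> pole_val a v \<or> b \<noteq> 0 \<and> pole_val (\<theta> * b) v)"
proof -
  have A1: "\<exists>v. d dvd v \<and> pole_val a v" if "a \<noteq> 0" using field_value assms(1) that by blast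
  have B1: "\<exists>w. d dvd w + int t \<and> pole_val (\<theta> * b) w" if nz: "b \<noteq> 0"
  proof -
    obtain w where "d dvd w" "pole_val b w" using field_value assms(2) nz by blast
    then show ?thesis
      using pole_val_mult[OF t(1)] by (intro exI[of _ "- int t + w"]) auto
  qed
  show ?thesis
  proof (cases "a = 0")
    case True
    then show ?thesis using B1 assms(3) by auto
  next
    case anz: False
    then obtain v where v: "d dvd v" "pole_val a v" using A1 by blast
    show ?thesis
    proof (cases "b = 0")
      case True
      then show ?thesis using v anz by auto
    next
      case bnz: False
      then obtain w where w: "d dvd w + int t" "pole_val (\<theta> * b) w" using B1 by blast
      have "v \<noteq> w"
        using v w t(2) by (metis dvd_add_right_iff)
      then consider "v < w" | "w < v" by linarith
      then show ?thesis
        using pole_val_add[OF v(2) w(2)] pole_val_add[OF w(2) v(2)] v w anz bnz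
        by cases (auto simp: add.commute)
    qed
  qed
qed

text \<open>The difference, a sum in characteristic 2, would have a value and so be nonzero unless
  both coordinates agree.\<close>

lemma adjoin2_unique:
  assumes "a \<in> E" "b \<in> E" "a' \<in> E" "b' \<in> E" "a + \<theta> * b = a' + \<theta> * b'"
  shows "a = a'" "b = b'"
proof -
  have "(a + a') + \<theta> * (b + b') = (a + \<theta> * b) + (a' + \<theta> * b')"
    by (simp add: algebra_simps)
  also have "\<dots> = 0" using assms(5) char2 by simp
  finally have "a + a' = 0 \<and> b + b' = 0"
    using value_adjoin2[of "a + a'" "b + b'"] subfieldD[OF E] assms pole_val_nz by metis
  then show "a = a'" "b = b'"
    by (metis add_self_left add.right_neutral)+
qed

text \<open>Products reduce to coordinates by \<open>\<theta> ^ 2 = \<theta> + c\<close>. The ring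
  \<open>B\<close> is general so as to cover both \<open>A\<close> and \<open>E\<close>.\<close>

lemma subring_adjoin2:
  assumes B: "subring_set B" and "A \<subseteq> B"
  shows "subring_set (adjoin2 B \<theta>)"
proof -
  have cB: "c \<in> B" using c_in_A assms by blast
  have "f - g \<in> adjoin2 B \<theta> \<and> f * g \<in> adjoin2 B \<theta>" if "f \<in> adjoin2 B \<theta>" "g \<in> adjoin2 B \<theta>" for f g
  proof -
    obtain a b where f: "a \<in> B" "b \<in> B" "f = a + \<theta> * b" using adjoin2E \<open>f \<in> _\<close> by metis
    obtain a' b' where g: "a' \<in> B" "b' \<in> B" "g = a' + \<theta> * b'" using adjoin2E \<open>g \<in> _\<close> by metis
    have "f - g = (a - a') + \<theta> * (b - b')" by (simp add: f g algebra_simps)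
    moreover have "f * g = (a * a' + c * (b * b')) + \<theta> * (a * b' + b * a' + b * b')"
    proof -
      have "f * g = a * a' + (\<theta> * \<theta>) * (b * b') + \<theta> * (a * b' + b * a')"
        by (simp add: f g algebra_simps)
      then show ?thesis unfolding theta_sq by (simp add: algebra_simps)
    qed
    ultimately show ?thesis
      using f g cB by (simp only:)
        (intro conjI adjoin2I subring_diff[OF B] subring_add[OF B] subring_mult[OF B])
  qed
  moreover have "1 \<in> adjoin2 B \<theta>"
    using adjoin2_superset[OF subring_zero[OF B]] subring_one[OF B] by blast
  ultimately show ?thesis by (simp add: subring_set_def)
qed

lemma subfield_adjoin2: "subfield_set (adjoin2 E \<theta>)"
proof -
  note S = subring_adjoin2[OF subfield_subring[OF E] AE]
  have "inverse f \<in> adjoin2 E \<theta>" if "f \<in> adjoin2 E \<theta>" for f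
  proof -
    obtain a b where f: "a \<in> E" "b \<in> E" "f = a + \<theta> * b" using adjoin2E \<open>f \<in> _\<close> by metis
    show ?thesis
    proof (cases "b = 0")
      case True
      then show ?thesis
        using f subfieldD[OF E] adjoin2_superset[of E \<theta>] by auto
    next
      case bnz: False
      \<comment> \<open>The conjugate of \<open>f\<close> under the substitution of
        \<open>\<theta> + 1\<close> for \<theta> is \<open>f + b\<close>, and \<open>N\<close> is
        the norm \<open>f * (f + b)\<close>.\<close>
      define N where "N = a * a + a * b + c * (b * b)"
      have NE: "inverse N \<in> E"
        unfolding N_def using f c_in_A AE by (intro subfieldD(3-5)[OF E]) auto
      have "f * (f + b) = a * a + a * b + (\<theta> * \<theta>) * (b * b) + \<theta> * (b * b) + (\<theta> * (a * b) + \<theta> * (a * b))"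
        by (simp add: f(3) algebra_simps)
      also have "\<dots> = N + (\<theta> * (b * b) + \<theta> * (b * b))"
        unfolding theta_sq char2 N_def by (simp only: algebra_simps) simp
      finally have fN: "f * (f + b) = N" by (simp only: char2) simp
      have fb: "f + b = (a + b) + \<theta> * b" by (simp add: f algebra_simps)
      have "f \<noteq> 0" "f + b \<noteq> 0"
        using value_adjoin2[of a b] value_adjoin2[of "a + b" b] f fb bnz subfieldD(3)[OF E] pole_val_nz
        by metis+
      then have "inverse f = (f + b) * inverse N"
        unfolding fN[symmetric] by (simp del: distrib_left)
      also have "\<dots> = (a + b) * inverse N + \<theta> * (b * inverse N)"
        unfolding fb by (simp add: algebra_simps)
      also have "\<dots> \<in> adjoin2 E \<theta>"
        using f NE by (intro adjoin2I subfieldD(3-4)[OF E]) auto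
      finally show ?thesis .
    qed
  qed
  then show ?thesis
    using subring_zero[OF S] subring_one[OF S] subring_add[OF S] subring_mult[OF S]
    by (simp add: subfield_set_def)
qed

text \<open>Squaring sends \<open>a' + \<theta> * e\<close> to
  \<open>(a' ^ 2 + c * e ^ 2) + \<theta> * e ^ 2\<close>, since the mixed terms cancel.\<close>

lemma frobenius_adjoin2:
  assumes "a \<in> E" "b \<in> E"
  shows "\<exists>a'\<in>E. (a + \<theta> * b) ^ 2 ^ k = a' + \<theta> * b ^ 2 ^ k"
proof (induction k)
  case 0
  then show ?case using assms by auto
next
  case (Suc k)
  then obtain a' where a': "a' \<in> E" "(a + \<theta> * b) ^ 2 ^ k = a' + \<theta> * b ^ 2 ^ k" by blast
  define e where "e = b ^ 2 ^ k"
  have "(a + \<theta> * b) ^ 2 ^ Suc k = (a' + \<theta> * e)\<^sup>2"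
    using a'(2) by (simp only: power_Suc2 power_mult e_def)
  also have "\<dots> = a' * a' + (\<theta> * \<theta>) * (e * e) + (\<theta> * (a' * e) + \<theta> * (a' * e))"
    by (simp add: power2_eq_square algebra_simps)
  also have "\<dots> = (a' * a' + c * (e * e)) + \<theta> * (e * e)"
    unfolding char2 theta_sq by (simp add: algebra_simps)
  also have "e * e = b ^ 2 ^ Suc k"
    by (simp only: e_def power_Suc2 power_mult power2_eq_square)
  finally have "(a + \<theta> * b) ^ 2 ^ Suc k = (a' * a' + c * b ^ 2 ^ Suc k) + \<theta> * b ^ 2 ^ Suc k" .
  moreover have "a' * a' + c * b ^ 2 ^ Suc k \<in> E"
    using a'(1) c_in_A AE subring_power[OF subfield_subring[OF E] assms(2)]
    by (intro subfieldD(3-4)[OF E]) auto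
  ultimately show ?case by blast
qed

text \<open>Comparing \<theta>-coordinates in \<open>D * f ^ 2 ^ k\<close> gives
  \<open>D * b ^ 2 ^ k \<in> A\<close>, so \<open>b \<in> A\<close> by \<open>closed\<close> one
  level down. Subtracting \<open>\<theta> * b\<close> then transfers the hypothesis to
  \<open>a\<close>.\<close>

lemma closed_adjoin2:
  assumes f: "f \<in> adjoin2 E \<theta>" and D: "D \<in> R" "D \<noteq> 0" and Df: "\<And>k. D * f ^ 2 ^ k \<in> adjoin2 A \<theta>"
  shows "f \<in> adjoin2 A \<theta>"
proof -
  note S = subring_adjoin2[OF A subset_refl]
  have DA: "D \<in> A" "D \<in> E" using D RA AE by auto
  obtain a b where ab: "a \<in> E" "b \<in> E" "f = a + \<theta> * b" using f adjoin2E by metis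
  have pE: "D * x ^ 2 ^ k \<in> E" if "x \<in> E" for x k
    using DA that subring_power[OF subfield_subring[OF E]] subfieldD(4)[OF E] by blast
  have "D * b ^ 2 ^ k \<in> A" for k
  proof -
    obtain a' where a': "a' \<in> E" "f ^ 2 ^ k = a' + \<theta> * b ^ 2 ^ k"
      using frobenius_adjoin2[OF ab(1,2)] ab(3) by blast
    obtain u v where uv: "u \<in> A" "v \<in> A" "D * f ^ 2 ^ k = u + \<theta> * v" using Df adjoin2E by metis
    have "D * a' + \<theta> * (D * b ^ 2 ^ k) = u + \<theta> * v"
      using uv a' by (simp add: algebra_simps)
    then have "D * b ^ 2 ^ k = v"
      using adjoin2_unique(2)[OF subfieldD(4)[OF E DA(2) a'(1)] pE[OF ab(2)]] uv AE by blast
    then show ?thesis using uv(2) by simp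
  qed
  then have bA: "b \<in> A" using closed[OF ab(2) D] by blast
  have tS: "\<theta> \<in> adjoin2 A \<theta>" and AS: "A \<subseteq> adjoin2 A \<theta>"
    using adjoin2_gen adjoin2_superset subring_zero[OF A] subring_one[OF A] by blast+
  have "D * a ^ 2 ^ k \<in> A" for k
  proof -
    have "D * a ^ 2 ^ k = D * f ^ 2 ^ k - D * (\<theta> * b) ^ 2 ^ k"
      unfolding ab(3) frobenius by (simp add: algebra_simps)
    also have "\<dots> \<in> adjoin2 A \<theta>"
      using DA bA AS tS
      by (intro subring_diff[OF S Df] subring_mult[OF S] subring_power[OF S]) auto
    finally obtain u v where uv: "u \<in> A" "v \<in> A" "D * a ^ 2 ^ k = u + \<theta> * v" using adjoin2E by metis
    then have "D * a ^ 2 ^ k + \<theta> * 0 = u + \<theta> * v" by simp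
    then have "D * a ^ 2 ^ k = u"
      using adjoin2_unique(1)[OF pE[OF ab(1)] subfieldD(1)[OF E]] uv AE by blast
    then show ?thesis using uv(1) by simp
  qed
  then have "a \<in> A" using closed[OF ab(1) D] by blast
  then show ?thesis using ab bA adjoin2I by metis
qed

text \<open>A value on the extension is that of one of the two summands, so the new pole orders are
  the old ones and their translates by \<open>t\<close>.\<close>

lemma next_level:
  "tower_level K z (adjoin2 E \<theta>) (adjoin2 A \<theta>) (d div 2) (\<Gamma> \<union> (\<lambda>s. t + s) ` \<Gamma>)"
proof unfold_locales
  show "subfield_set (adjoin2 E \<theta>)" by (rule subfield_adjoin2)
  show "subring_set (adjoin2 A \<theta>)" by (rule subring_adjoin2[OF A subset_refl])
  show "adjoin2 A \<theta> \<subseteq> adjoin2 E \<theta>" using AE by (auto simp: adjoin2_def)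
  show "R \<subseteq> adjoin2 A \<theta>" using RA adjoin2_superset[OF subring_zero[OF A]] by blast
next
  fix f assume "f \<in> adjoin2 E \<theta>"
  then obtain a b where ab: "a \<in> E" "b \<in> E" "f = a + \<theta> * b" using adjoin2E by metis
  obtain D1 where D1: "D1 \<in> R" "D1 \<noteq> 0" "D1 * a \<in> A" using denominator ab by blast
  obtain D2 where D2: "D2 \<in> R" "D2 \<noteq> 0" "D2 * b \<in> A" using denominator ab by blast
  have "D1 * D2 * f = D2 * (D1 * a) + \<theta> * (D1 * (D2 * b))" by (simp add: ab algebra_simps)
  also have "\<dots> \<in> adjoin2 A \<theta>"
    using D1 D2 RA by (intro adjoin2I subring_mult[OF A _ D1(3)] subring_mult[OF A _ D2(3)]) auto
  finally show "\<exists>D\<in>R. D \<noteq> 0 \<and> D * f \<in> adjoin2 A \<theta>"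
    using D1 D2 by (intro bexI[of _ "D1 * D2"] conjI subring_mult[OF subring_R]) auto
next
  fix f assume "f \<in> adjoin2 E \<theta>" "f \<noteq> 0"
  then obtain a b where ab: "a \<in> E" "b \<in> E" "f = a + \<theta> * b" using adjoin2E by metis
  then obtain v where v: "pole_val f v" "a \<noteq> 0 \<and> pole_val a v \<or> b \<noteq> 0 \<and> pole_val (\<theta> * b) v"
    using value_adjoin2[of a b] \<open>f \<noteq> 0\<close> by (metis add_0 mult_zero_right)
  have dd: "d div 2 dvd d" using d_even by (metis dvd_div_mult_self dvd_triv_left)
  from v(2) have "d div 2 dvd v"
  proof
    assume "a \<noteq> 0 \<and> pole_val a v"
    then show ?thesis using field_value[OF ab(1)] pole_val_unique dd dvd_trans by metis
  next
    assume b: "b \<noteq> 0 \<and> pole_val (\<theta> * b) v"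
    then obtain w where w: "d dvd w" "pole_val b w" using field_value[OF ab(2)] by blast
    then have "v = - int t + w" using b pole_val_mult[OF t(1)] pole_val_unique by blast
    then show ?thesis using t(3) dvd_trans[OF dd w(1)] by simp
  qed
  then show "\<exists>v. d div 2 dvd v \<and> pole_val f v" using v by blast
next
  fix f assume "f \<in> adjoin2 A \<theta>" "f \<noteq> 0"
  then obtain a b where ab: "a \<in> A" "b \<in> A" "f = a + \<theta> * b" using adjoin2E by metis
  then obtain v where v: "pole_val f v" "a \<noteq> 0 \<and> pole_val a v \<or> b \<noteq> 0 \<and> pole_val (\<theta> * b) v"
    using value_adjoin2[of a b] \<open>f \<noteq> 0\<close> AE by (metis add_0 mult_zero_right subsetD)
  from v(2) have "\<exists>s\<in>\<Gamma> \<union> (\<lambda>s. t + s) ` \<Gamma>. v = - int s"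
  proof
    assume "a \<noteq> 0 \<and> pole_val a v"
    then show ?thesis using pole_orders[OF ab(1)] pole_val_unique by blast
  next
    assume b: "b \<noteq> 0 \<and> pole_val (\<theta> * b) v"
    then obtain s where s: "s \<in> \<Gamma>" "pole_val b (- int s)" using pole_orders[OF ab(2)] by blast
    then have "v = - int t + - int s" using b pole_val_mult[OF t(1)] pole_val_unique by blast
    then show ?thesis using s by (intro bexI[of _ "t + s"]) auto
  qed
  then show "\<exists>s\<in>\<Gamma> \<union> (\<lambda>s. t + s) ` \<Gamma>. pole_val f (- int s)" using v by blast
next
  fix s assume "s \<in> \<Gamma> \<union> (\<lambda>s. t + s) ` \<Gamma>"
  then consider "s \<in> \<Gamma>" | s' where "s' \<in> \<Gamma>" "s = t + s'" by blast
  then show "\<exists>f\<in>adjoin2 A \<theta>. pole_val f (- int s)"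
  proof cases
    case 1
    then show ?thesis
      using pole_orders_attained adjoin2_superset[OF subring_zero[OF A]] by blast
  next
    case 2
    then obtain f where f: "f \<in> A" "pole_val f (- int s')" using pole_orders_attained by blast
    have "0 + \<theta> * f \<in> adjoin2 A \<theta>" using f subring_zero[OF A] by (intro adjoin2I)
    moreover have "pole_val (\<theta> * f) (- int s)" using pole_val_mult[OF t(1) f(2)] 2 by simp
    ultimately show ?thesis by auto
  qed
next
  show "f \<in> adjoin2 A \<theta>"
    if "f \<in> adjoin2 E \<theta>" "D \<in> R" "D \<noteq> 0" "\<And>k. D * f ^ 2 ^ k \<in> adjoin2 A \<theta>" for f D
    by (rule closed_adjoin2[OF that])
qed

end

section \<open>The Weierstrass semigroup\<close>

lemma (in char2_pole) pole_val_powi: "pole_val f v \<Longrightarrow> pole_val (f powi k) (k * v)"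
proof (cases "k \<ge> 0")
  case True
  then show "pole_val f v \<Longrightarrow> ?thesis"
    using pole_val_power[of f v "nat k"] by (simp add: power_int_def)
next
  case False
  then show "pole_val f v \<Longrightarrow> ?thesis"
    using pole_val_power[OF pole_val_inverse[of f v], of "nat (- k)"] by (simp add: power_int_def)
qed

lemma (in char2_pole) pole_val_in_place_iff:
  "pole_val f v \<Longrightarrow> place K P \<Longrightarrow> z \<notin> P \<Longrightarrow> f \<in> P \<longleftrightarrow> v \<ge> 0"
  using has_val_in_place_iff[OF K] pole_valD by metis

lemma (in char2_pole) pole_val_unit_iff:
  "pole_val f v \<Longrightarrow> place K P \<Longrightarrow> z \<notin> P \<Longrightarrow> f \<in> place_units P \<longleftrightarrow> v = 0"
  using has_val_unit_iff[OF K] pole_valD by metis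

section \<open>Places and regular functions at the top of the tower\<close>

text \<open>The tower has reached the whole field, and \<open>T\<close> is a local parameter at the
  pole; it links values to \<open>place_val\<close>, which is defined through prime
  elements.\<close>

locale tower_top = tower_level K z "UNIV :: 'f set" A 1 \<Gamma> for K :: "'f::field set" and z A \<Gamma> +
  fixes T :: 'f
  assumes T: "pole_val T 1"
    and A_regular: "place K Q \<Longrightarrow> z \<in> Q \<Longrightarrow> A \<subseteq> Q"
begin

lemma value_exists: "f \<noteq> 0 \<Longrightarrow> \<exists>v. pole_val f v"
  using field_value[of f] by auto

text \<open>Whether \<open>f\<close> is regular at a pole of \<open>z\<close> depends only on its
  value, which is common to all poles.\<close>

lemma pole_unique:
  assumes "place K P" "z \<notin> P" "place K Q" "z \<notin> Q"
  shows "P = Q"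
proof -
  have "f \<in> P \<longleftrightarrow> f \<in> Q" for f
  proof (cases "f = 0")
    case True
    then show ?thesis using place_zero[OF K] assms by blast
  next
    case False
    then obtain v where "pole_val f v" using value_exists by blast
    then show ?thesis using pole_val_in_place_iff assms by simp
  qed
  then show ?thesis by blast
qed

lemma common_denominator: "\<exists>D\<in>R. D \<noteq> 0 \<and> (\<forall>i\<le>N. D * f ^ i \<in> A)"
proof (induction N)
  case 0
  have "\<exists>D\<in>R. D \<noteq> 0 \<and> D * 1 \<in> A" by (rule denominator) simp
  then show ?case by simp
next
  case (Suc N)
  then obtain D where D: "D \<in> R" "D \<noteq> 0" "\<forall>i\<le>N. D * f ^ i \<in> A" by blast
  obtain D' where D': "D' \<in> R" "D' \<noteq> 0" "D' * f ^ Suc N \<in> A"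
    using denominator[of "f ^ Suc N"] by blast
  have "D * D' * f ^ i \<in> A" if "i \<le> Suc N" for i
  proof (cases "i = Suc N")
    case True
    have "D * (D' * f ^ Suc N) \<in> A" using D(1) RA D'(3) subring_mult[OF A] by blast
    then show ?thesis using True by (simp only: mult.assoc)
  next
    case False
    then have "D * f ^ i \<in> A" using D(3) that by simp
    then have "D' * (D * f ^ i) \<in> A" using D'(1) RA subring_mult[OF A] by blast
    then show ?thesis by (simp only: mult_ac)
  qed
  then show ?case
    using D D' subring_mult[OF subring_R] by (intro bexI[of _ "D * D'"]) auto
qed

text \<open>A valuation ring containing \<open>A\<close> but not \<open>f\<close> would be a place
  where \<open>z\<close> is regular and \<open>f\<close> is not. Hence \<open>f\<close> is integral
  over \<open>A\<close>, its powers have a common denominator, and \<open>closed\<close>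
  applies.\<close>

lemma regular_in_A:
  assumes reg: "\<And>Q. place K Q \<Longrightarrow> z \<in> Q \<Longrightarrow> f \<in> Q"
  shows "f \<in> A"
proof (cases "f = 0")
  case True
  then show ?thesis using subring_zero[OF A] by simp
next
  case nz: False
  have "f \<in> adjoin A (inverse f)"
  proof (rule ccontr)
    assume "f \<notin> adjoin A (inverse f)"
    from valuation_ring_avoiding[OF A this] obtain V where V: "subring_set V" "A \<subseteq> V" "f \<notin> V"
      "\<forall>u. u \<in> V \<or> inverse u \<in> V" by blast
    \<comment> \<open>\<open>place\<close> asks for \<open>K\<close> to be a proper subset of
      \<open>V\<close>; the witness is \<open>z\<close>, which is outside \<open>K\<close> because
      it has a pole.\<close>
    obtain P where "place K P" "z \<notin> P" using pole_exists by blast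
    then have "z \<notin> K" using field_subset_place[OF K] by blast
    moreover have zV: "z \<in> V" using z_in_R RA V(2) by blast
    moreover have "K \<subseteq> V" using K_subset_R RA V(2) by blast
    ultimately have "place K V"
      using V by (auto simp: place_def subring_set_def)
    then show False using reg zV V(3) by blast
  qed
  then obtain p where p: "p \<in> polys A" "f = poly p (inverse f)"
    by (auto simp: adjoin_def)
  \<comment> \<open>Reversing \<open>p\<close> turns \<open>f = p (1 / f)\<close> into
    \<open>f ^ Suc N = q (f)\<close> with \<open>degree q \<le> N\<close>, which reduces all powers
    of \<open>f\<close> to those up to \<open>N\<close>.\<close>
  define q where "q = reflect_poly p"
  define N where "N = degree p"
  have q: "coeff q i \<in> A" for i
    using p(1) subring_zero[OF A] by (simp add: q_def coeff_reflect_poly polys_def)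
  have "degree q \<le> N" by (simp add: q_def N_def degree_reflect_poly_le)
  have rel: "f ^ Suc N = poly q f"
    using p(2) nz by (simp add: q_def N_def poly_reflect_poly_nz mult.commute)
  obtain D where D: "D \<in> R" "D \<noteq> 0" "\<forall>i\<le>N. D * f ^ i \<in> A"
    using common_denominator by blast
  have "D * f ^ k \<in> A" for k
  proof (induction k rule: less_induct)
    case (less k)
    show ?case
    proof (cases "k \<le> N")
      case True
      then show ?thesis using D by simp
    next
      case False
      define j where "j = k - Suc N"
      have k: "k = Suc N + j" using False by (simp add: j_def)
      have "D * f ^ k = poly q f * (D * f ^ j)"
        by (simp add: k power_add rel[symmetric] mult_ac)
      also have "\<dots> = (\<Sum>i\<le>degree q. coeff q i * (D * f ^ (i + j)))"
        by (simp add: poly_altdef sum_distrib_left sum_distrib_right power_add mult_ac)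
      also have "\<dots> \<in> A"
      proof (rule subring_sum[OF A], rule subring_mult[OF A q less])
        fix i assume "i \<in> {..degree q}"
        then show "i + j < k" using \<open>degree q \<le> N\<close> k by simp
      qed
      finally show ?thesis .
    qed
  qed
  then show ?thesis using closed[OF UNIV_I D(1,2)] by blast
qed

context
  fixes P assumes P: "place K P" "z \<notin> P"
begin

text \<open>Dividing a nonunit of \<open>P\<close> by an element of value 1 leaves a value of at
  least 0. Conversely a generator of the maximal ideal divides \<open>T\<close>, so its positive
  value is at most 1.\<close>

lemma prime_element_iff: "prime_element P t \<longleftrightarrow> pole_val t 1"
proof -
  have multiples: "P - place_units P = {t * a | a. a \<in> P}" if t: "pole_val t 1" for t
  proof (intro subset_antisym subsetI)
    fix f assume f: "f \<in> P - place_units P"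
    have tnz: "t \<noteq> 0" using pole_val_nz[OF t] .
    have "inverse t * f \<in> P"
    proof (cases "f = 0")
      case True
      then show ?thesis using place_zero[OF K P(1)] by simp
    next
      case False
      then obtain v where v: "pole_val f v" using value_exists by blast
      then have "v \<ge> 0" "v \<noteq> 0"
        using f pole_val_in_place_iff[OF v P] pole_val_unit_iff[OF v P] by auto
      then show ?thesis
        using pole_val_in_place_iff[OF pole_val_mult[OF pole_val_inverse[OF t] v] P] by simp
    qed
    moreover have "f = t * (inverse t * f)" using tnz by simp
    ultimately show "f \<in> {t * a | a. a \<in> P}" by blast
  next
    fix f assume "f \<in> {t * a | a. a \<in> P}"
    then obtain a where a: "f = t * a" "a \<in> P" by blast
    show "f \<in> P - place_units P"
    proof (cases "a = 0")
      case True
      then show ?thesis using a by (simp add: place_units_def)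
    next
      case False
      then obtain v where v: "pole_val a v" using value_exists by blast
      then have "v \<ge> 0" using a pole_val_in_place_iff[OF v P] by simp
      moreover have "pole_val f (1 + v)" using pole_val_mult[OF t v] a by simp
      ultimately show ?thesis
        using pole_val_in_place_iff[of f "1 + v"] pole_val_unit_iff[of f "1 + v"] P by auto
    qed
  qed
  show ?thesis
  proof
    assume t: "prime_element P t"
    have one: "1 \<in> P" by (rule place_one[OF K P(1)])
    have sets: "{t * a | a. a \<in> P} = P - place_units P" "P - place_units P = {T * a | a. a \<in> P}"
      using t multiples[OF T] by (simp_all add: prime_element_def)
    have "t * 1 \<in> P - place_units P" using one sets(1) by blast
    then have tP: "t \<in> P" "t \<notin> place_units P" by simp_all
    have "T * 1 \<in> P - place_units P" using one sets(2) by blast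
    then obtain a where a: "T = t * a" "a \<in> P" unfolding sets(1)[symmetric] by auto
    then have "t \<noteq> 0" "a \<noteq> 0" using pole_val_nz[OF T] by auto
    then obtain v w where vw: "pole_val t v" "pole_val a w" using value_exists by blast
    have "v \<ge> 0" "v \<noteq> 0" "w \<ge> 0"
      using tP a pole_val_in_place_iff[OF vw(1) P] pole_val_unit_iff[OF vw(1) P]
        pole_val_in_place_iff[OF vw(2) P] by auto
    moreover have "v + w = 1"
      using pole_val_unique[OF T] pole_val_mult[OF vw] a by simp
    ultimately have "v = 1" by linarith
    then show "pole_val t 1" using vw by simp
  next
    assume "pole_val t 1"
    then show "prime_element P t" using multiples by (simp add: prime_element_def)
  qed
qed

text \<open>\<open>f * T powi (- v)\<close> has value 0 and is a unit, which gives existence for the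
  definite description; in any decomposition the exponent is the value of \<open>f\<close>, which
  gives uniqueness.\<close>

lemma place_val_eq:
  assumes f: "pole_val f v"
  shows "place_val P f = v"
  unfolding place_val_def
proof (rule the_equality)
  define u where "u = f * T powi (- v)"
  have "pole_val u 0"
    using pole_val_mult[OF f pole_val_powi[OF T, of "- v"]] by (simp add: u_def)
  then have "u \<in> place_units P" using pole_val_unit_iff P by blast
  moreover have "f = u * T powi v"
    using pole_val_nz[OF T] by (simp add: u_def power_int_minus)
  ultimately show "\<exists>t u. prime_element P t \<and> u \<in> place_units P \<and> f = u * t powi v"
    using T prime_element_iff by blast
next
  fix w assume "\<exists>t u. prime_element P t \<and> u \<in> place_units P \<and> f = u * t powi w"
  then obtain t u where tu: "prime_element P t" "u \<in> place_units P" "f = u * t powi w" by blast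
  then have t: "pole_val t 1" using prime_element_iff by blast
  have "u \<noteq> 0" using tu by (simp add: place_units_def)
  then obtain e where e: "pole_val u e" using value_exists by blast
  then have "e = 0" using pole_val_unit_iff[OF e P] tu by simp
  then have "pole_val f w"
    using pole_val_mult[OF e pole_val_powi[OF t, of w]] tu by simp
  then show "w = v" using pole_val_unique f by blast
qed

text \<open>The places other than \<open>P\<close> are exactly those where \<open>z\<close> is
  regular, so \<open>regular_in_A\<close> and \<open>A_regular\<close> identify the functions in
  question with \<open>A\<close>.\<close>

theorem weierstrass_semigroup_eq: "weierstrass_semigroup K P = \<Gamma>"
proof (intro subset_antisym subsetI)
  fix r assume "r \<in> weierstrass_semigroup K P"
  then obtain f where f: "f \<noteq> 0" "\<forall>Q. place K Q \<and> Q \<noteq> P \<longrightarrow> f \<in> Q" "nat (- place_val P f) = r"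
    by (auto simp: weierstrass_semigroup_def)
  have "f \<in> A"
  proof (rule regular_in_A)
    show "f \<in> Q" if "place K Q" "z \<in> Q" for Q using f(2) that P by blast
  qed
  then obtain s where s: "s \<in> \<Gamma>" "pole_val f (- int s)" using pole_orders f(1) by blast
  then show "r \<in> \<Gamma>" using f(3) place_val_eq[OF s(2)] by simp
next
  fix s assume "s \<in> \<Gamma>"
  then obtain f where f: "f \<in> A" "pole_val f (- int s)" using pole_orders_attained by blast
  have "f \<in> Q" if "place K Q" "Q \<noteq> P" for Q
    using A_regular[OF that(1)] pole_unique[OF P that(1)] that(2) f(1) by blast
  then show "s \<in> weierstrass_semigroup K P"
    using f(2) place_val_eq[OF f(2)] pole_val_nz[OF f(2)]
    unfolding weierstrass_semigroup_def by (intro CollectI exI[of _ f]) auto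
qed

end

end

section \<open>The function field of the GGS curve\<close>

text \<open>Translation by 1 permutes \<open>K\<close>, so summing over \<open>K\<close> shows that
  \<open>card K\<close>, a power of 2, vanishes in the field.\<close>

lemma subfield_char2:
  fixes K :: "'f::field set"
  assumes K: "subfield_set K" and fin: "finite K" and card: "card K = 2 ^ N"
  shows "a + a = (0::'f)"
proof -
  have "bij_betw (\<lambda>a. a + 1) K K"
  proof (rule bij_betw_byWitness[where f' = "\<lambda>a. a + - 1"])
    show "(\<lambda>a. a + 1) ` K \<subseteq> K" "(\<lambda>a. a + - 1) ` K \<subseteq> K"
      using K unfolding subfield_set_def by blast+
  qed auto
  then have "(\<Sum>a\<in>K. a + 1) = (\<Sum>a\<in>K. a)"
    using sum.reindex_bij_betw[of "\<lambda>a. a + 1" K K "\<lambda>a. a"] by simp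
  then have "of_nat (card K) = (0::'f)" by (simp add: sum.distrib)
  then have "(2::'f) = 0" by (simp add: card)
  then show ?thesis by (metis mult_2 mult_zero_left)
qed

definition ggs_semigroup :: "nat \<Rightarrow> nat set" where
  "ggs_semigroup m = {3 * i * m + 2 * j * m + 8 * k | i j k. i \<le> 1 \<and> j \<le> 3}"

theorem ggs_weierstrass_semigroup:
  fixes K P :: "'f::field set"
  assumes n: "n \<ge> 3" and m: "3 * m = 2 ^ n + 1"
    and ggs: "GGS_function_field n m K x y z" and inf: "place_at_infinity K x y z P"
  shows "weierstrass_semigroup K P = ggs_semigroup m"
proof -
  have K: "subfield_set K" "finite K" "card K = 2 ^ (2 * n)"
    and curve: "x ^ 2 + x = y ^ 3" "y ^ 4 - y = z ^ m"
    and gen: "subfield_set hull (K \<union> {x, y, z}) = UNIV"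
    using ggs by (auto simp: GGS_function_field_def)
  have char2: "a + a = (0::'f)" for a
    by (rule subfield_char2[OF K])
  \<comment> \<open>\<open>u\<close> splits the quartic equation into two quadratic ones:
    \<open>u ^ 2 + u = y ^ 4 + y\<close> in characteristic 2.\<close>
  define u where "u = y\<^sup>2 + y"
  have "u\<^sup>2 + u = y ^ 4 - y + (y ^ 3 + y ^ 3) + ((y\<^sup>2 + y\<^sup>2) + (y + y))"
    by (simp add: u_def power2_eq_square eval_nat_numeral algebra_simps)
  then have u: "u\<^sup>2 + u = z ^ m"
    unfolding char2 using curve by simp
  \<comment> \<open>Where \<open>z\<close> is regular, so are \<open>u\<close>, \<open>y\<close> and
    \<open>x\<close> in turn; a place at infinity is therefore a pole of \<open>z\<close>.\<close>
  have integral: "u \<in> Q \<and> y \<in> Q \<and> x \<in> Q" if Q: "place K Q" "z \<in> Q" for Q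
  proof -
    note as = artin_schreier_in_place[OF K(1) Q(1)] and pw = place_power[OF K(1) Q(1)]
    have uQ: "u \<in> Q" by (rule as) (simp add: u pw Q)
    have yQ: "y \<in> Q" by (rule as) (use uQ in \<open>simp add: u_def\<close>)
    have "x \<in> Q" by (rule as) (simp add: curve pw yQ)
    then show ?thesis using uQ yQ by blast
  qed
  have P: "place K P" "z \<notin> P"
    using inf integral by (auto simp: place_at_infinity_def)
  interpret char2_pole K z
    by unfold_locales (use K char2 P in auto)
  have odd_m: "odd m"
  proof
    assume "even m"
    then have "even (2 ^ n + 1 :: nat)" using m by (metis even_mult_iff)
    then show False using n by simp
  qed
  then obtain q where q: "m = 2 * q + 1" using oddE by blast
  have "m > 0" using q by simp
  have vz: "pole_val (z ^ m) (2 * (- 4 * int m))"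
    using pole_val_power[OF pole_val_gen, of m] by (simp add: algebra_simps)
  have vu: "pole_val u (- int (4 * m))"
    using pole_val_artin_schreier[of u "- 4 * int m"] vz u \<open>m > 0\<close> by simp
  have vy: "pole_val y (- int (2 * m))"
    using pole_val_artin_schreier[of y "- 2 * int m"] vu \<open>m > 0\<close> by (simp add: u_def)
  have vx: "pole_val x (- int (3 * m))"
    using pole_val_artin_schreier[of x "- 3 * int m"] pole_val_power[OF vy, of 3] curve(1) \<open>m > 0\<close>
    by simp
  \<comment> \<open>The translations by \<open>4 * m\<close> and \<open>2 * m\<close> supply the
    binary digits of \<open>j\<close>, the one by \<open>3 * m\<close> supplies
    \<open>i\<close>.\<close>
  let ?E0 = "{a * inverse b | a b. a \<in> R \<and> b \<in> R \<and> b \<noteq> 0}" and ?G0 = "{8 * k | k. True} :: nat set"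
  let ?E1 = "adjoin2 ?E0 u" and ?A1 = "adjoin2 R u" and ?G1 = "?G0 \<union> (\<lambda>s. 4 * m + s) ` ?G0"
  let ?E2 = "adjoin2 ?E1 y" and ?A2 = "adjoin2 ?A1 y" and ?G2 = "?G1 \<union> (\<lambda>s. 2 * m + s) ` ?G1"
  let ?E3 = "adjoin2 ?E2 x" and ?A3 = "adjoin2 ?A2 x" and ?G3 = "?G2 \<union> (\<lambda>s. 3 * m + s) ` ?G2"
  interpret L0: tower_level K z ?E0 R 8 ?G0 by (rule base_level)
  \<comment> \<open>Because \<open>m\<close> is odd, \<open>4 * m\<close>, \<open>2 * m\<close> and
    \<open>3 * m\<close> are not divisible by 8, 4 and 2 respectively.\<close>
  interpret S0: artin_schreier_step K z ?E0 R 8 ?G0 u "4 * m"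
  proof
    show "u\<^sup>2 + u \<in> R" unfolding u by (rule subring_power[OF subring_R z_in_R])
    show "\<not> 8 dvd int (4 * m)" using q by presburger
    show "(8::int) div 2 dvd int (4 * m)" by simp
  qed (use vu in simp_all)
  have l1: "tower_level K z ?E1 ?A1 4 ?G1" using S0.next_level by simp
  interpret L1: tower_level K z ?E1 ?A1 4 ?G1 by (rule l1)
  have uA1: "u \<in> ?A1"
    by (rule adjoin2_gen[OF subring_zero[OF subring_R] subring_one[OF subring_R]])
  interpret S1: artin_schreier_step K z ?E1 ?A1 4 ?G1 y "2 * m"
  proof
    show "y\<^sup>2 + y \<in> ?A1" using uA1 by (simp add: u_def)
    show "\<not> 4 dvd int (2 * m)" using q by presburger
    show "(4::int) div 2 dvd int (2 * m)" by simp
  qed (use vy in simp_all)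
  have l2: "tower_level K z ?E2 ?A2 2 ?G2" using S1.next_level by simp
  interpret L2: tower_level K z ?E2 ?A2 2 ?G2 by (rule l2)
  have yA2: "y \<in> ?A2"
    by (rule adjoin2_gen[OF subring_zero[OF L1.A] subring_one[OF L1.A]])
  interpret S2: artin_schreier_step K z ?E2 ?A2 2 ?G2 x "3 * m"
  proof
    show "x\<^sup>2 + x \<in> ?A2" unfolding curve by (rule subring_power[OF L2.A yA2])
    show "\<not> 2 dvd int (3 * m)" using q by presburger
  qed (use vx in simp_all)
  have l3: "tower_level K z ?E3 ?A3 1 ?G3" using S2.next_level by simp
  interpret L3: tower_level K z ?E3 ?A3 1 ?G3 by (rule l3)
  have A23: "?A2 \<subseteq> ?A3" by (rule adjoin2_superset[OF subring_zero[OF L2.A]])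
  have "x \<in> ?A3"
    by (rule adjoin2_gen[OF subring_zero[OF L2.A] subring_one[OF L2.A]])
  then have "K \<union> {x, y, z} \<subseteq> ?E3"
    using K_subset_R z_in_R L3.RA L3.AE yA2 A23 by blast
  then have E3: "?E3 = UNIV"
    using hull_minimal[of "K \<union> {x, y, z}" ?E3 subfield_set] gen L3.E by auto
  interpret L3': tower_level K z UNIV ?A3 1 ?G3 using l3 unfolding E3 .
  \<comment> \<open>\<open>8 * 2 ^ (n - 3) = 2 ^ n = 3 * m - 1\<close>, so \<open>z ^ r / x\<close>
    has value \<open>3 * m - 8 * r = 1\<close>.\<close>
  define r :: nat where "r = 2 ^ (n - 3)"
  have r: "8 * r + 1 = 3 * m"
  proof -
    have "(2::nat) ^ n = 2 ^ (3 + (n - 3))" using n by simp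
    then show ?thesis unfolding m r_def by (simp only: power_add) simp
  qed
  have "pole_val (z ^ r * inverse x) (int r * - 8 + - (- int (3 * m)))"
    by (intro pole_val_mult pole_val_power pole_val_inverse pole_val_gen vx)
  also have "int r * - 8 + - (- int (3 * m)) = 1"
    using r by linarith
  finally have T: "pole_val (z ^ r * inverse x) 1" .
  interpret tower_top K z ?A3 ?G3 "z ^ r * inverse x"
  proof
    fix Q assume Q: "place K Q" "z \<in> Q"
    note SQ = place_subring[OF K(1) Q(1)]
    have step: "adjoin2 B \<theta> \<subseteq> Q" if "B \<subseteq> Q" "\<theta> \<in> Q" for B \<theta>
      using that by (auto simp: adjoin2_def intro!: subring_add[OF SQ] subring_mult[OF SQ])
    have "K \<subseteq> Q" using field_subset_place[OF K(1) Q(1)] by blast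
    then have "R \<subseteq> Q"
      using poly_in_subring[OF SQ _ Q(2)] by (auto simp: adjoin_def polys_def)
    then show "?A3 \<subseteq> Q"
      using integral[OF Q] by (intro step) auto
  qed (rule T)
  have "?G3 = ggs_semigroup m"
  proof (intro subset_antisym subsetI)
    fix s assume "s \<in> ?G3"
    then obtain i j k where s: "i \<le> 1" "j \<le> 3" "s = 3 * i * m + 2 * j * m + 8 * k"
    proof -
      assume *: "\<And>i j k. i \<le> 1 \<Longrightarrow> j \<le> 3 \<Longrightarrow> s = 3 * i * m + 2 * j * m + 8 * k \<Longrightarrow> thesis"
      from \<open>s \<in> ?G3\<close> show thesis
        by (elim UnE imageE CollectE exE conjE)
          (use *[of 0 0] *[of 0 1] *[of 0 2] *[of 0 3] *[of 1 0] *[of 1 1] *[of 1 2] *[of 1 3] in auto)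
    qed
    then show "s \<in> ggs_semigroup m" by (auto simp: ggs_semigroup_def)
  next
    fix s assume "s \<in> ggs_semigroup m"
    then obtain i j k where s: "i \<le> 1" "j \<le> 3" "s = 3 * i * m + 2 * j * m + 8 * k"
      by (auto simp: ggs_semigroup_def)
    have g0: "8 * k \<in> ?G0" by blast
    from s(2) have "j = 0 \<or> j = 1 \<or> j = 2 \<or> j = 3" by auto
    then have g2: "2 * j * m + 8 * k \<in> ?G2"
      using g0 by (elim disjE) (auto simp: image_iff)
    from s(1) have "i = 0 \<or> i = 1" by auto
    then show "s \<in> ?G3"
    proof
      assume "i = 0"
      then show ?thesis using s(3) g2 by simp
    next
      assume "i = 1"
      then have "s = 3 * m + (2 * j * m + 8 * k)" using s(3) by simp
      then show ?thesis using g2 by blast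
    qed
  qed
  then show ?thesis using weierstrass_semigroup_eq[OF P] by simp
qed

section \<open>The order bound\<close>

text \<open>Every \<open>a \<le> s\<close> is the first entry of a pair unless \<open>a\<close> or
  \<open>s - a\<close> is a gap; each case excludes at most \<open>g\<close> numbers.\<close>

lemma nu_lower_bound:
  fixes S :: "nat set"
  assumes fin: "finite (- S)" and g: "card (- S) \<le> g"
  shows "s + 1 \<le> card {(a, b). a \<in> S \<and> b \<in> S \<and> a + b = s} + 2 * g"
proof -
  let ?N = "{(a, b). a \<in> S \<and> b \<in> S \<and> a + b = s}"
  have "?N \<subseteq> {..s} \<times> {..s}" by auto
  then have finN: "finite ?N" by (rule finite_subset) simp
  have "{..s} \<subseteq> fst ` ?N \<union> (- S \<union> (\<lambda>a. s - a) ` (- S))"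
  proof
    fix a assume "a \<in> {..s}"
    then have a: "a + (s - a) = s" "a = s - (s - a)" by auto
    show "a \<in> fst ` ?N \<union> (- S \<union> (\<lambda>a. s - a) ` (- S))"
    proof (cases "a \<in> S \<and> s - a \<in> S")
      case True
      then have "(a, s - a) \<in> ?N" using a by simp
      then show ?thesis by force
    next
      case False
      then show ?thesis using a(2) by blast
    qed
  qed
  then have "card {..s} \<le> card (fst ` ?N \<union> (- S \<union> (\<lambda>a. s - a) ` (- S)))"
    using finN fin by (intro card_mono) auto
  also have "\<dots> \<le> card (fst ` ?N) + card (- S \<union> (\<lambda>a. s - a) ` (- S))" by (rule card_Un_le)
  also have "\<dots> \<le> card ?N + (card (- S) + card ((\<lambda>a. s - a) ` (- S)))"
    by (intro add_mono card_image_le finN card_Un_le)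
  also have "\<dots> \<le> card ?N + (g + g)"
    using card_image_le[OF fin, of "\<lambda>a. s - a"] g by linarith
  finally show ?thesis by simp
qed

section \<open>Gaps and pairs in the explicit semigroup\<close>

context
  fixes m q :: nat
  assumes m: "m = 8 * q + 3"
begin

text \<open>The numbers \<open>3im + 2jm\<close> are the least elements of the semigroup in their residue
  classes modulo 8, so the class of \<open>e\<close> contributes \<open>e div 8\<close> gaps.\<close>

lemma ggs_gaps: "finite (- ggs_semigroup m)" "2 * card (- ggs_semigroup m) \<le> 9 * m - 7"
proof -
  let ?I = "{..1::nat} \<times> {..3::nat}"
  let ?e = "\<lambda>(i, j). 3 * i * m + 2 * j * m"
  let ?B = "\<lambda>p. (\<lambda>t. ?e p mod 8 + 8 * t) ` {..<?e p div 8}"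
  have sub: "- ggs_semigroup m \<subseteq> (\<Union>p\<in>?I. ?B p)"
  proof
    fix s assume s: "s \<in> - ggs_semigroup m"
    \<comment> \<open>As \<open>m\<close> is 3 modulo 8, the eight numbers
      \<open>3 * i * m + 2 * j * m\<close> represent all residues modulo 8.\<close>
    have "\<exists>p\<in>?I. s mod 8 = ?e p mod 8"
    proof -
      have res: "3 * m mod 8 = 1" "6 * m mod 8 = 2" "9 * m mod 8 = 3" "4 * m mod 8 = 4"
        "7 * m mod 8 = 5" "2 * m mod 8 = 6" "5 * m mod 8 = 7"
        unfolding m by presburger+
      have e: "?e (0, 0) mod 8 = 0" "?e (1, 0) mod 8 = 1" "?e (0, 3) mod 8 = 2" "?e (1, 3) mod 8 = 3"
        "?e (0, 2) mod 8 = 4" "?e (1, 2) mod 8 = 5" "?e (0, 1) mod 8 = 6" "?e (1, 1) mod 8 = 7"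
        using res by simp_all
      have "s mod 8 \<in> {0, 1, 2, 3, 4, 5, 6, 7}" by auto
      then show ?thesis
      proof (elim insertE emptyE)
        show ?thesis if "s mod 8 = 0" using e that by (intro bexI[of _ "(0, 0)"]) simp_all
        show ?thesis if "s mod 8 = 1" using e that by (intro bexI[of _ "(1, 0)"]) simp_all
        show ?thesis if "s mod 8 = 2" using e that by (intro bexI[of _ "(0, 3)"]) simp_all
        show ?thesis if "s mod 8 = 3" using e that by (intro bexI[of _ "(1, 3)"]) simp_all
        show ?thesis if "s mod 8 = 4" using e that by (intro bexI[of _ "(0, 2)"]) simp_all
        show ?thesis if "s mod 8 = 5" using e that by (intro bexI[of _ "(1, 2)"]) simp_all
        show ?thesis if "s mod 8 = 6" using e that by (intro bexI[of _ "(0, 1)"]) simp_all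
        show ?thesis if "s mod 8 = 7" using e that by (intro bexI[of _ "(1, 1)"]) simp_all
      qed
    qed
    then obtain p where p: "p \<in> ?I" "s mod 8 = ?e p mod 8" by blast
    define e where "e = ?e p"
    have e: "s mod 8 = e mod 8" using p(2) by (simp only: e_def)
    have "s < e"
    proof (rule ccontr)
      assume "\<not> s < e"
      then have "8 dvd s - e" using e by (metis mod_eq_dvd_iff_nat not_less)
      then obtain k where "s = e + 8 * k"
        using \<open>\<not> s < e\<close> by (metis dvdE le_add_diff_inverse not_less)
      then have "s \<in> ggs_semigroup m"
        using p(1) unfolding ggs_semigroup_def e_def by (auto split: prod.splits)
      then show False using s by simp
    qed
    then have "s div 8 < e div 8"
      using e mult_div_mod_eq[of 8 s] mult_div_mod_eq[of 8 e] by linarith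
    moreover have "s = e mod 8 + 8 * (s div 8)"
      using e mult_div_mod_eq[of 8 s] by linarith
    ultimately have "s \<in> (\<lambda>t. e mod 8 + 8 * t) ` {..<e div 8}"
      by blast
    then have "s \<in> ?B p" by (simp only: e_def)
    then show "s \<in> (\<Union>p\<in>?I. ?B p)" using p(1) by blast
  qed
  have fin: "finite (\<Union>p\<in>?I. ?B p)" by blast
  then show "finite (- ggs_semigroup m)" using sub finite_subset by blast
  have "card (- ggs_semigroup m) \<le> card (\<Union>p\<in>?I. ?B p)" by (rule card_mono[OF fin sub])
  also have "\<dots> \<le> (\<Sum>p\<in>?I. card (?B p))" by (rule card_UN_le) simp
  also have "\<dots> \<le> (\<Sum>p\<in>?I. ?e p div 8)"
    by (intro sum_mono) (metis card_image_le card_lessThan finite_lessThan)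
  also have "\<dots> = (\<Sum>i\<le>1. \<Sum>j\<le>3. (3 * i * m + 2 * j * m) div 8)"
    by (simp add: sum.cartesian_product split_def)
  \<comment> \<open>For \<open>m = 8 * q + 3\<close> this is the genus
    \<open>(9 * m - 7) / 2\<close>.\<close>
  also have "\<dots> = 36 * q + 10"
  proof -
    have expand: "(\<Sum>i\<le>1. \<Sum>j\<le>3. F i j) = (F 0 0 + F 0 1 + F 0 2 + F 0 3) + (F 1 0 + F 1 1 + F 1 2 + F 1 3)"
      for F :: "nat \<Rightarrow> nat \<Rightarrow> nat"
      by (simp add: numeral_3_eq_3 numeral_2_eq_2)
    have "(3 * 0 * m + 2 * 0 * m) div 8 = 0" "(3 * 0 * m + 2 * 1 * m) div 8 = 2 * q"
      "(3 * 0 * m + 2 * 2 * m) div 8 = 4 * q + 1" "(3 * 0 * m + 2 * 3 * m) div 8 = 6 * q + 2"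
      "(3 * 1 * m + 2 * 0 * m) div 8 = 3 * q + 1" "(3 * 1 * m + 2 * 1 * m) div 8 = 5 * q + 1"
      "(3 * 1 * m + 2 * 2 * m) div 8 = 7 * q + 2" "(3 * 1 * m + 2 * 3 * m) div 8 = 9 * q + 3"
      unfolding m by presburger+
    then show ?thesis unfolding expand by linarith
  qed
  finally show "2 * card (- ggs_semigroup m) \<le> 9 * m - 7" unfolding m by simp
qed

text \<open>The total coefficient \<open>w\<close> of \<open>m\<close> is 1 modulo 8 since
  \<open>m\<close> is invertible there, and it cannot be 1, so it is at least 9 and leaves
  \<open>t + t' \<le> k\<close>. The pair is thus determined by one of
  \<open>2 * 4 * (k + 1)\<close> triples \<open>(i, j, t)\<close>.\<close>

lemma nu_upper_bound:
  "card {(a, b). a \<in> ggs_semigroup m \<and> b \<in> ggs_semigroup m \<and> a + b = 9 * m + 8 * k} \<le> 8 * (k + 1)"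
proof -
  let ?h = "\<lambda>(i, j, t). (3 * i * m + 2 * j * m + 8 * t, 9 * m + 8 * k - (3 * i * m + 2 * j * m + 8 * t))"
  let ?I = "{..1::nat} \<times> {..3::nat} \<times> {..k}"
  have "{(a, b). a \<in> ggs_semigroup m \<and> b \<in> ggs_semigroup m \<and> a + b = 9 * m + 8 * k} \<subseteq> ?h ` ?I"
  proof clarify
    fix a b assume ab: "a \<in> ggs_semigroup m" "b \<in> ggs_semigroup m" "a + b = 9 * m + 8 * k"
    then obtain i j t i' j' t' where a: "i \<le> 1" "j \<le> 3" "a = 3 * i * m + 2 * j * m + 8 * t"
      and b: "i' \<le> 1" "j' \<le> 3" "b = 3 * i' * m + 2 * j' * m + 8 * t'"
      by (auto simp: ggs_semigroup_def)
    define w where "w = 3 * (i + i') + 2 * (j + j')"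
    have sum: "w * m + 8 * (t + t') = 9 * m + 8 * k"
      using ab(3) a(3) b(3) by (simp add: w_def algebra_simps)
    then have "8 * (w * q) + 3 * w + 8 * (t + t') = 9 * (8 * q + 3) + 8 * k"
      unfolding m by (simp add: algebra_simps)
    then have "w mod 8 = 1" by presburger
    moreover have "w \<noteq> 1" unfolding w_def by presburger
    ultimately have "9 \<le> w" by presburger
    then have "9 * m \<le> w * m" by (rule mult_le_mono1)
    then have "8 * (t + t') \<le> 8 * k"
      using sum by (metis add_le_cancel_left add_le_mono1)
    then have "t \<le> k" by simp
    moreover have "(a, b) = ?h (i, j, t)" using ab(3) a(3) by auto
    ultimately show "(a, b) \<in> ?h ` ?I" using a(1,2) by blast
  qed
  then have "card {(a, b). a \<in> ggs_semigroup m \<and> b \<in> ggs_semigroup m \<and> a + b = 9 * m + 8 * k}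
      \<le> card (?h ` ?I)"
    by (intro card_mono) auto
  also have "\<dots> \<le> card ?I" by (rule card_image_le) simp
  also have "\<dots> = 8 * (k + 1)" by (simp add: card_cartesian_product)
  finally show ?thesis .
qed

end

lemma d_ORD_eqI:
  assumes "\<And>r. r \<ge> l \<Longrightarrow> sg_nu H l \<le> sg_nu H r"
  shows "d_ORD H l = sg_nu H l"
  unfolding d_ORD_def
proof (rule antisym)
  show "(INF r\<in>{l..}. sg_nu H r) \<le> sg_nu H l" by (rule cINF_lower) auto
  show "sg_nu H l \<le> (INF r\<in>{l..}. sg_nu H r)" by (rule cINF_greatest) (use assms in auto)
qed

theorem lemma3p5:
  fixes K P :: "'f::field set" and x y z :: 'f and n m l k :: nat and H :: "nat set"
  assumes "n \<ge> 5" and "odd n" and "m = (2 ^ n + 1) div 3"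
    and "GGS_function_field n m K x y z"
    and "place_at_infinity K x y z P"
    and "H = weierstrass_semigroup K P"
    and "l \<ge> 1" and "k < m"
    and "sg_rho H (l + 1) = 9 * m + 8 * k"
  shows "d_ORD H l = sg_nu H l"
proof (rule d_ORD_eqI)
  fix r assume "l \<le> r"
  \<comment> \<open>For odd \<open>n\<close> the number \<open>2 ^ n + 1\<close> is divisible by 3,
    so the division defining \<open>m\<close> is exact.\<close>
  have "(2::nat) ^ n mod 3 = 2"
    using \<open>odd n\<close>
  proof (elim oddE)
    fix b assume b: "n = 2 * b + 1"
    have "(4::nat) ^ b mod 3 = 1" by (induction b) (simp, simp, presburger)
    then show ?thesis by (simp add: b power_mult) presburger
  qed
  then have m3: "3 * m = 2 ^ n + 1" using assms(3) by presburger
  have H: "H = ggs_semigroup m"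
    using ggs_weierstrass_semigroup[OF _ m3 assms(4,5)] assms(1,6) by simp
  \<comment> \<open>Modulo 8 this gives \<open>3 * m = 1\<close>, hence
    \<open>m = 3\<close>.\<close>
  have "(2::nat) ^ 3 dvd 2 ^ n" by (rule le_imp_power_dvd) (use assms(1) in simp)
  then have "(8::nat) dvd 2 ^ n" by simp
  then obtain N where "(2::nat) ^ n = 8 * N" by (elim dvdE)
  then have "m mod 8 = 3" using m3 by presburger
  then obtain q where q: "m = 8 * q + 3" by (metis mod_div_mult_eq mult.commute add.commute)
  note gaps = ggs_gaps[OF q, folded H]
  have "infinite H" using gaps(1) by (metis finite_Un infinite_UNIV_nat Compl_partition)
  then have "sg_rho H (l + 1) \<le> sg_rho H (r + 1)"
    unfolding sg_rho_def using \<open>l \<le> r\<close> by (simp add: enumerate_mono_le_iff)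
  then have "9 * m + 8 * k + 1 \<le> sg_nu H r + 2 * card (- H)"
    using nu_lower_bound[OF gaps(1) le_refl, of "sg_rho H (r + 1)"] assms(9)
    unfolding sg_nu_def by linarith
  \<comment> \<open>\<open>9 * m + 8 * k + 1 - (9 * m - 7) = 8 * (k + 1)\<close>, the number that
    also bounds \<open>sg_nu H l\<close> from above.\<close>
  then have "8 * (k + 1) \<le> sg_nu H r" using gaps(2) q by arith
  moreover have "sg_nu H l \<le> 8 * (k + 1)"
    unfolding sg_nu_def assms(9) unfolding H by (rule nu_upper_bound[OF q])
  ultimately show "sg_nu H l \<le> sg_nu H r" by linarith
qed

end
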